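(* Assume that: (i) for each $i$, $X_i$ is convex, $f_i$ and every component of $g_i$ are convex on $X_i$, $h_i$ is affine on $X_i$, and problem (CC) has at least one optimal solution; (ii) (Slater) there exist $\tilde x_i\in\mathrm{relint}\,X_i$, $i=1,\dots,N$, with $\sum_{i=1}^N g_i(\tilde x_i)<\mathbf 0_m$ (componentwise) and $\sum_{i=1}^N h_i(\tilde x_i)=\mathbf 0_p$; (iii) $P_A,P_H,P_{\tilde H}\in\mathbb R^{N\times N}$ are symmetric positive semidefinite with $P_A+\rho P_H\succ 0$, $P_H\succeq P_{\tilde H}$ and $\mathrm{Null}(P_H)=\mathrm{Null}(P_{\tilde H})=\mathrm{span}(\mathbf 1_N)$; (iv) each $X_i$ is compact; (v) $P_A+\rho P_H$ is diagonal. Let $\{\mathbf x^k\}_{k\ge1},\{\mathbf y^k\}_{k\ge0},\{\mathbf z^k\}_{k\ge0}$ be generated by DUCA. Then for any $k\ge1$, $$-\frac{R_1}{k}\le f(\bar{\mathbf x}^k)-f(\mathbf x^\star)\le\frac{R_2}{k},$$ where $R_1=\|y^\star\|\sqrt{N\lambda_1(P_A)}\big(\|\mathbf y^0-\mathbf y^\star\|_A+\|\mathbf s^0-\mathbf s^\star\|_G\big)$ and $R_2=\frac1{2\rho}\|\mathbf v^0-\mathbf v^\star\|_{\tilde H^\dagger}^2+\frac12\|\mathbf y^0\|_A^2$.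
   Context: Problem (CC): minimize $\sum_{i=1}^N f_i(x_i)$ over $x_i\in X_i\subseteq\mathbb R^{d_i}$, $i=1,\dots,N$, subject to $\sum_{i=1}^N g_i(x_i)\le\mathbf 0_m$ and $\sum_{i=1}^N h_i(x_i)=\mathbf 0_p$, where $f_i:\mathbb R^{d_i}\to\mathbb R$, $g_i:\mathbb R^{d_i}\to\mathbb R^m$, $h_i:\mathbb R^{d_i}\to\mathbb R^p$. Write $\mathbf x=[x_1^T,\dots,x_N^T]^T$, $X=X_1\times\dots\times X_N$, $f(\mathbf x)=\sum_i f_i(x_i)$, $\tilde g(\mathbf x)=[g_1(x_1)^T,h_1(x_1)^T,\dots,g_N(x_N)^T,h_N(x_N)^T]^T\in\mathbb R^{N(m+p)}$. Under (i)-(ii) there exists a primal-dual optimal pair $(\mathbf x^\star,(\mu^\star,\lambda^\star))$ with $\mu^\star\in\mathbb R^m_+$, $\lambda^\star\in\mathbb R^p$: $\mathbf x^\star$ is optimal for (CC), $(\mu^\star,\lambda^\star)$ is optimal for the Lagrange dual (maximize $\inf_{\mathbf x\in X}f(\mathbf x)+\langle\mu,\sum_i g_i(x_i)\rangle+\langle\lambda,\sum_i h_i(x_i)\rangle$ over $\mu\in\mathbb R^m_+$, $\lambda\in\mathbb R^p$), there is zero duality gap, and $\mathbf x^\star\in\arg\min_{\mathbf x\in X}f(\mathbf x)+\langle\mu^\star,\sum_i g_i(x_i)\rangle+\langle\lambda^\star,\sum_i h_i(x_i)\rangle$. Fix such a pair. Vectors $\mathbf y\in\mathbb R^{N(m+p)}$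 are partitioned as $\mathbf y=[y_1^T,\dots,y_N^T]^T$, $y_i=[\mu_i^T,\lambda_i^T]^T$, $\mu_i\in\mathbb R^m$, $\lambda_i\in\mathbb R^p$; $\mathcal K=\{\mathbf y:\mu_i\in\mathbb R^m_+\ \forall i\}$. $\mathcal P_{\mathcal K}$ is Euclidean projection onto $\mathcal K$. $\rho>0$ is a parameter; $A=P_A\otimes I_{m+p}$, $H=P_H\otimes I_{m+p}$, $\tilde H=P_{\tilde H}\otimes I_{m+p}$, $D=A+\rho H$. $\|\cdot\|$ is the Euclidean norm, $\|z\|_M=\sqrt{z^TMz}$ for symmetric positive semidefinite $M$, $M^\dagger$ is the Moore–Penrose pseudoinverse, $\lambda_1(\cdot)$ is the largest eigenvalue. DUCA: from arbitrary $\mathbf y^0\in\mathcal K$, $\mathbf z^0\in\mathbb R^{N(m+p)}$, for $k\ge0$: $\mathbf x^{k+1}\in\arg\min_{\mathbf x\in X}\{f(\mathbf x)+\frac12\|\mathcal P_{\mathcal K}[A\mathbf y^k-\tilde H^{1/2}\mathbf z^k+\tilde g(\mathbf x)]\|_{D^{-1}}^2\}$ (any minimizer); $\mathbf y^{k+1}=\mathcal P_{\mathcal K}[D^{-1}(A\mathbf y^k-\tilde H^{1/2}\mathbf z^k+\tilde g(\mathbf x^{k+1}))]$; $\mathbf z^{k+1}=\mathbf z^k+\rho\tilde H^{1/2}\mathbf y^{k+1}$. Further notation: $y^\star=[(\mu^\star)^T,(\lambda^\star)^T]^T$, $\mathbf y^\star=\mathbf 1_N\otimes y^\star$, $\mathbf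 z^\star=(\tilde H^{1/2})^\dagger\tilde g(\mathbf x^\star)$, $\mathbf v^k=\tilde H^{1/2}\mathbf z^k$, $\mathbf v^\star=\tilde H^{1/2}\mathbf z^\star$, $\mathbf s^k=[(\mathbf y^k)^T,(\mathbf z^k)^T]^T$, $\mathbf s^\star=[(\mathbf y^\star)^T,(\mathbf z^\star)^T]^T$, $G=\mathrm{diag}(A,I_{N(m+p)}/\rho)$ (block diagonal), $\bar{\mathbf x}^k=\frac1k\sum_{l=1}^k\mathbf x^l$. *)

theory Defs
  imports "HOL-Analysis.Analysis"
begin

section \<open>Matrices\<close>

definition sym_psd :: "real^'a^'a \<Rightarrow> bool" where
  "sym_psd M \<longleftrightarrow> transpose M = M \<and> (\<forall>x. 0 \<le> x \<bullet> (M *v x))"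

definition sym_pd :: "real^'a^'a \<Rightarrow> bool" where
  "sym_pd M \<longleftrightarrow> transpose M = M \<and> (\<forall>x. x \<noteq> 0 \<longrightarrow> 0 < x \<bullet> (M *v x))"

definition diagonal :: "real^'a^'a \<Rightarrow> bool" where
  "diagonal M \<longleftrightarrow> (\<forall>i j. i \<noteq> j \<longrightarrow> M $ i $ j = 0)"

definition null_space :: "real^'a^'b \<Rightarrow> (real^'a) set" where
  "null_space M = {x. M *v x = 0}"

definition eigenvalue :: "real^'a^'a \<Rightarrow> real \<Rightarrow> bool" where
  "eigenvalue M l \<longleftrightarrow> (\<exists>v. v \<noteq> 0 \<and> M *v v = l *\<^sub>R v)"

definition lambda_max :: "real^'a^'a \<Rightarrow> real" where
  "lambda_max M = Max {l. eigenvalue M l}"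

(* Meaningful only for symmetric positive semidefinite M, where such an R exists and is unique. *)
definition psd_sqrt :: "real^'a^'a \<Rightarrow> real^'a^'a" where
  "psd_sqrt M = (THE R. sym_psd R \<and> R ** R = M)"

(* The four Penrose conditions, which have exactly one solution for every real matrix. *)
definition pinv :: "real^'a^'b \<Rightarrow> real^'b^'a" where
  "pinv M = (THE Q. M ** Q ** M = M \<and> Q ** M ** Q = Q
     \<and> transpose (M ** Q) = M ** Q \<and> transpose (Q ** M) = Q ** M)"

definition wnorm :: "real^'a^'a \<Rightarrow> real^'a \<Rightarrow> real" where
  "wnorm M z = sqrt (z \<bullet> (M *v z))"

definition kron :: "real^'a^'b \<Rightarrow> real^'c^'d \<Rightarrow> real^('a \<times> 'c)^('b \<times> 'd)" where
  "kron P Q = (\<chi> r c. P $ fst r $ fst c * Q $ snd r $ snd c)"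

(* The vector 1_N \<otimes> y, that is, N stacked copies of y. *)
definition replicate_vec :: "real^'c \<Rightarrow> real^('n::finite \<times> 'c)" where
  "replicate_vec y = (\<chi> r. y $ snd r)"

definition stack :: "real^'a \<Rightarrow> real^'b \<Rightarrow> real^('a + 'b)" where
  "stack u v = (\<chi> c. case c of Inl a \<Rightarrow> u $ a | Inr b \<Rightarrow> v $ b)"

definition block_diag :: "real^'a^'a \<Rightarrow> real^'b^'b \<Rightarrow> real^('a + 'b)^('a + 'b)" where
  "block_diag M Q = (\<chi> r c. case (r, c) of
      (Inl i, Inl j) \<Rightarrow> M $ i $ j
    | (Inr i, Inr j) \<Rightarrow> Q $ i $ j
    | _ \<Rightarrow> 0)"


section \<open>The constraint-coupled problem\<close>

(* The agents are the elements of the finite type 'n, so N = CARD('n); likewise m = CARD('m)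
   and p = CARD('p). The local dimensions d_i may differ from agent to agent: R^(d_i) is the
   coordinate subspace of real^'d given by a set of d_i coordinates, 'd being large enough to
   index the coordinates of every agent. The stacked decision variable has x_i = x $ i. *)
definition coord_subspace :: "'d set \<Rightarrow> (real^'d) set" where
  "coord_subspace C = {v. \<forall>j. j \<notin> C \<longrightarrow> v $ j = 0}"

(* Affinity on a convex set S; h need not be affine, nor even meaningful, outside S. *)
definition affine_on :: "'a::real_vector set \<Rightarrow> ('a \<Rightarrow> 'b::real_vector) \<Rightarrow> bool" where
  "affine_on S h \<longleftrightarrow> (\<forall>x\<in>S. \<forall>y\<in>S. \<forall>u\<ge>0. \<forall>v\<ge>0. u + v = 1 \<longrightarrow>
     h (u *\<^sub>R x + v *\<^sub>R y) = u *\<^sub>R h x + v *\<^sub>R h y)"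

definition prod_set :: "('n \<Rightarrow> (real^'d) set) \<Rightarrow> (real^'d^'n) set" where
  "prod_set X = {x. \<forall>i. x $ i \<in> X i}"

definition agent_sum :: "('n \<Rightarrow> real^'d \<Rightarrow> 'b::comm_monoid_add) \<Rightarrow> real^'d^'n \<Rightarrow> 'b" where
  "agent_sum f x = (\<Sum>i\<in>UNIV. f i (x $ i))"

definition cc_feasible ::
  "('n \<Rightarrow> (real^'d) set) \<Rightarrow> ('n \<Rightarrow> real^'d \<Rightarrow> real^'m) \<Rightarrow> ('n \<Rightarrow> real^'d \<Rightarrow> real^'p) \<Rightarrow>
   real^'d^'n \<Rightarrow> bool" where
  "cc_feasible X g h x \<longleftrightarrow> x \<in> prod_set X \<and> (\<forall>a. agent_sum g x $ a \<le> 0) \<and> agent_sum h x = 0"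

definition cc_optimal ::
  "('n \<Rightarrow> (real^'d) set) \<Rightarrow> ('n \<Rightarrow> real^'d \<Rightarrow> real) \<Rightarrow> ('n \<Rightarrow> real^'d \<Rightarrow> real^'m) \<Rightarrow>
   ('n \<Rightarrow> real^'d \<Rightarrow> real^'p) \<Rightarrow> real^'d^'n \<Rightarrow> bool" where
  "cc_optimal X f g h = is_arg_min (agent_sum f) (cc_feasible X g h)"

definition slater ::
  "('n::finite \<Rightarrow> (real^'d) set) \<Rightarrow> ('n \<Rightarrow> real^'d \<Rightarrow> real^'m) \<Rightarrow> ('n \<Rightarrow> real^'d \<Rightarrow> real^'p) \<Rightarrow> bool" where
  "slater X g h \<longleftrightarrow> (\<exists>x. (\<forall>i. x $ i \<in> rel_interior (X i))
     \<and> (\<forall>a. agent_sum g x $ a < 0) \<and> agent_sum h x = 0)"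

definition lagrangian ::
  "('n \<Rightarrow> real^'d \<Rightarrow> real) \<Rightarrow> ('n \<Rightarrow> real^'d \<Rightarrow> real^'m) \<Rightarrow> ('n \<Rightarrow> real^'d \<Rightarrow> real^'p) \<Rightarrow>
   real^'m \<Rightarrow> real^'p \<Rightarrow> real^'d^'n \<Rightarrow> real" where
  "lagrangian f g h \<mu> la x = agent_sum f x + \<mu> \<bullet> agent_sum g x + la \<bullet> agent_sum h x"

definition dual_fun ::
  "('n::finite \<Rightarrow> (real^'d) set) \<Rightarrow> ('n \<Rightarrow> real^'d \<Rightarrow> real) \<Rightarrow> ('n \<Rightarrow> real^'d \<Rightarrow> real^'m) \<Rightarrow>
   ('n \<Rightarrow> real^'d \<Rightarrow> real^'p) \<Rightarrow> real^'m \<Rightarrow> real^'p \<Rightarrow> ereal" where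
  "dual_fun X f g h \<mu> la = (INF x\<in>prod_set X. ereal (lagrangian f g h \<mu> la x))"

definition primal_dual_optimal ::
  "('n \<Rightarrow> (real^'d) set) \<Rightarrow> ('n \<Rightarrow> real^'d \<Rightarrow> real) \<Rightarrow> ('n \<Rightarrow> real^'d \<Rightarrow> real^'m) \<Rightarrow>
   ('n \<Rightarrow> real^'d \<Rightarrow> real^'p) \<Rightarrow> real^'d^'n \<Rightarrow> real^'m \<Rightarrow> real^'p \<Rightarrow> bool" where
  "primal_dual_optimal X f g h x \<mu> la \<longleftrightarrow>
     cc_optimal X f g h x
   \<and> is_arg_max (\<lambda>(\<mu>', la'). dual_fun X f g h \<mu>' la') (\<lambda>(\<mu>', la'). \<forall>a. 0 \<le> \<mu>' $ a) (\<mu>, la)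
   \<and> dual_fun X f g h \<mu> la = ereal (agent_sum f x)
   \<and> is_arg_min (lagrangian f g h \<mu> la) (\<lambda>x'. x' \<in> prod_set X) x"


section \<open>The algorithm\<close>

(* Vectors of R^(N(m+p)) are indexed by 'n \<times> ('m + 'p): entry (i, Inl a) is the a-th entry
   of \<mu>_i (or g_i) and entry (i, Inr b) is the b-th entry of \<lambda>_i (or h_i). *)
definition g_tilde ::
  "('n \<Rightarrow> real^'d \<Rightarrow> real^'m::finite) \<Rightarrow> ('n \<Rightarrow> real^'d \<Rightarrow> real^'p::finite) \<Rightarrow> real^'d^'n \<Rightarrow>
   real^('n \<times> ('m + 'p))" where
  "g_tilde g h x = (\<chi> r. stack (g (fst r) (x $ fst r)) (h (fst r) (x $ fst r)) $ snd r)"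

definition cone_K :: "(real^('n::finite \<times> ('m::finite + 'p::finite))) set" where
  "cone_K = {y. \<forall>i a. 0 \<le> y $ (i, Inl a)}"

definition proj_K :: "real^('n::finite \<times> ('m::finite + 'p::finite)) \<Rightarrow> real^('n \<times> ('m + 'p))" where
  "proj_K = closest_point cone_K"

(* Hs stands for the square root of H-tilde. The iterate x 0 is not constrained and plays no role. *)
definition duca ::
  "('n \<Rightarrow> (real^'d) set) \<Rightarrow> ('n \<Rightarrow> real^'d \<Rightarrow> real) \<Rightarrow> ('n \<Rightarrow> real^'d \<Rightarrow> real^'m::finite) \<Rightarrow>
   ('n \<Rightarrow> real^'d \<Rightarrow> real^'p::finite) \<Rightarrow>
   real^('n \<times> ('m + 'p))^('n \<times> ('m + 'p)) \<Rightarrow> real^('n \<times> ('m + 'p))^('n \<times> ('m + 'p)) \<Rightarrow>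
   real^('n \<times> ('m + 'p))^('n \<times> ('m + 'p)) \<Rightarrow> real \<Rightarrow>
   (nat \<Rightarrow> real^'d^'n) \<Rightarrow> (nat \<Rightarrow> real^('n \<times> ('m + 'p))) \<Rightarrow> (nat \<Rightarrow> real^('n \<times> ('m + 'p))) \<Rightarrow>
   bool" where
  "duca X f g h A Hs D \<rho> x y z \<longleftrightarrow>
     y 0 \<in> cone_K \<and>
     (\<forall>k. is_arg_min
            (\<lambda>x'. agent_sum f x' + (1/2) *
               (wnorm (matrix_inv D) (proj_K (A *v y k - Hs *v z k + g_tilde g h x')))\<^sup>2)
            (\<lambda>x'. x' \<in> prod_set X)
            (x (Suc k))
        \<and> y (Suc k) =
            proj_K (matrix_inv D *v (A *v y k - Hs *v z k + g_tilde g h (x (Suc k))))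
        \<and> z (Suc k) = z k + \<rho> *\<^sub>R (Hs *v y (Suc k)))"

end

theory Submission
  imports Defs
begin

text \<open>
  For \<open>Y\<close> in the cone with \<open>H Y = 0\<close> and for \<open>Z\<close> with \<open>H\<^sub>s Z = v\<^sup>*\<close>, the Lyapunov function
  \<open>V\<^sub>k = \<parallel>y\<^sup>k - Y\<parallel>\<^sub>A\<^sup>2 + \<parallel>z\<^sup>k - Z\<parallel>\<^sup>2 / \<rho>\<close> satisfies
  \<open>V\<^sub>k\<^sub>+\<^sub>1 - V\<^sub>k \<le> 2 (f(x\<^sup>*) - f(x\<^sup>k\<^sup>+\<^sup>1) - \<langle>Y, g(x\<^sup>k\<^sup>+\<^sup>1)\<rangle>)\<close>, \<open>g\<close> being the stacked constraint map.
  This combines the first-order optimality of the primal step with complementarity in the dual step,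
  which the diagonality of \<open>D\<close> makes a componentwise statement. With \<open>Y = 0\<close> the inequality
  telescopes to the upper bound. With \<open>Y = y\<^sup>*\<close> the saddle point property makes its right-hand side
  nonpositive, so \<open>\<parallel>y\<^sup>k - y\<^sup>*\<parallel>\<^sub>A\<close> stays bounded; since \<open>\<langle>y\<^sup>*, g(x\<^sup>k\<^sup>+\<^sup>1)\<rangle> \<le> \<langle>y\<^sup>*, A (y\<^sup>k\<^sup>+\<^sup>1 - y\<^sup>k)\<rangle>\<close>
  telescopes too, the lower bound follows from Cauchy--Schwarz and
  \<open>f(x) - f(x\<^sup>*) \<ge> - \<langle>y\<^sup>*, g(x)\<rangle>\<close>.
\<close>

section \<open>Symmetric matrices\<close>

lemma inner_symmetric_matrix:
  fixes M :: "real^'a^'a"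
  assumes "transpose M = M"
  shows "x \<bullet> (M *v y) = (M *v x) \<bullet> y"
  by (metis assms dot_lmul_matrix transpose_matrix_vector)

lemma matrix_vector_mult_sum:
  fixes M :: "real^'a^'b"
  shows "M *v (\<Sum>i\<in>S. u i) = (\<Sum>i\<in>S. M *v u i)"
  by (rule linear_sum) simp

text \<open>The difference of the two sides of \<open>bound\<close> is a quadratic polynomial in
  \<open>t\<close> that vanishes at 0 and keeps its sign, so its linear coefficient is zero. For a
  unit vector \<open>e\<close> and \<open>w\<close> orthogonal to it, \<open>bound\<close> says that
  \<open>e\<close> maximizes the Rayleigh quotient along \<open>e + t *\<^sub>R w\<close>.\<close>

lemma quadratic_form_eq_0:
  fixes M :: "real^'a^'a"
  assumes "transpose M = M" and bound: "\<And>t. (e + t *\<^sub>R w) \<bullet> (M *v (e + t *\<^sub>R w)) \<le> e \<bullet> (M *v e) * (1 + t\<^sup>2 * (w \<bullet> w))"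
  shows "w \<bullet> (M *v e) = 0"
proof (rule ccontr)
  define b where "b = w \<bullet> (M *v e)"
  define a where "a = w \<bullet> (M *v w) - e \<bullet> (M *v e) * (w \<bullet> w)"
  assume "w \<bullet> (M *v e) \<noteq> 0"
  then have "b \<noteq> 0" by (simp add: b_def)
  have sym: "e \<bullet> (M *v w) = b"
    using inner_symmetric_matrix[OF assms(1), of e w] by (simp add: b_def inner_commute)
  have ineq: "2 * t * b + t\<^sup>2 * a \<le> 0" for t
    using bound[of t] sym
    by (simp add: a_def b_def matrix_vector_right_distrib matrix_vector_mult_scaleR inner_add_left
        inner_add_right algebra_simps power2_eq_square)
  \<comment> \<open>This \<open>t\<close> has the sign of \<open>b\<close> and is so small that the
    linear term outweighs the quadratic one.\<close>
  define t where "t = b / (\<bar>a\<bar> + 1)"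
  have "t * (\<bar>a\<bar> + 1) = b" by (simp add: t_def)
  then have "t \<noteq> 0" "b = t * (\<bar>a\<bar> + 1)" using \<open>b \<noteq> 0\<close> by auto
  then have "2 * t * b + t\<^sup>2 * a = t\<^sup>2 * (2 * \<bar>a\<bar> + 2 + a)"
    by (simp add: power2_eq_square algebra_simps)
  moreover have "t\<^sup>2 * (2 * \<bar>a\<bar> + 2 + a) > 0"
    using \<open>t \<noteq> 0\<close> by (intro mult_pos_pos) auto
  ultimately show False using ineq[of t] by linarith
qed

text \<open>A maximizer of the quadratic form on the unit sphere of \<open>S\<close> is an
  eigenvector, and its orthogonal complement within \<open>S\<close> is again invariant and of
  smaller dimension. The statement is about invariant subspaces so that the induction can pass to
  this complement.\<close>

lemma symmetric_matrix_eigenbasis_subspace: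
  fixes M :: "real^'a^'a"
  assumes sym: "transpose M = M" and "subspace S" and "\<And>x. x \<in> S \<Longrightarrow> M *v x \<in> S"
  shows "\<exists>B. pairwise orthogonal B \<and> (\<forall>e\<in>B. norm e = 1 \<and> (\<exists>c. M *v e = c *\<^sub>R e)) \<and> span B = S"
  using assms(2,3)
proof (induction "dim S" arbitrary: S rule: less_induct)
  case less
  show ?case
  proof (cases "S \<subseteq> {0}")
    case True
    then have "S = {0}" using less.prems(1) subspace_0 by blast
    then show ?thesis by (intro exI[of _ "{}"]) auto
  next
    case False
    then obtain x0 where x0: "x0 \<in> S" "x0 \<noteq> 0" by auto
    define T where "T = S \<inter> sphere 0 1"
    have "compact T" unfolding T_def
      using closed_subspace[OF less.prems(1)] by (auto intro: closed_Int_compact)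
    moreover have "inverse (norm x0) *\<^sub>R x0 \<in> T"
      using x0 less.prems(1) by (auto simp: T_def intro: subspace_scale)
    then have "T \<noteq> {}" by auto
    moreover have "continuous_on T (\<lambda>x. x \<bullet> (M *v x))"
      by (intro continuous_intros matrix_vector_mult_linear_continuous_on)
    ultimately obtain e where e: "e \<in> T" "\<And>x. x \<in> T \<Longrightarrow> x \<bullet> (M *v x) \<le> e \<bullet> (M *v e)"
      using continuous_attains_sup[of T "\<lambda>x. x \<bullet> (M *v x)"] by blast
    define c where "c = e \<bullet> (M *v e)"
    have eS: "e \<in> S" and ne: "norm e = 1" using e(1) by (auto simp: T_def)
    have ee: "e \<bullet> e = 1" using ne by (simp add: norm_eq_1)
    have max: "x \<bullet> (M *v x) \<le> c * (x \<bullet> x)" if "x \<in> S" for x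
    proof (cases "x = 0")
      case False
      let ?u = "inverse (norm x) *\<^sub>R x"
      have "?u \<in> T" using that False less.prems(1) by (auto simp: T_def intro: subspace_scale)
      from e(2)[OF this] have "x \<bullet> (M *v x) / (norm x)\<^sup>2 \<le> c"
        by (simp add: c_def matrix_vector_mult_scaleR power2_eq_square field_simps)
      then show ?thesis using False
        by (simp add: divide_le_eq power2_norm_eq_inner[symmetric])
    qed simp
    have ortho: "w \<bullet> (M *v e) = 0" if "w \<in> S" "w \<bullet> e = 0" for w
    proof (rule quadratic_form_eq_0[OF sym])
      fix t
      have "e + t *\<^sub>R w \<in> S" using eS that(1) less.prems(1) by (simp add: subspace_add subspace_scale)
      from max[OF this] show "(e + t *\<^sub>R w) \<bullet> (M *v (e + t *\<^sub>R w)) \<le> e \<bullet> (M *v e) * (1 + t\<^sup>2 * (w \<bullet> w))"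
        using that(2) ee by (simp add: c_def inner_add_left inner_add_right inner_commute power2_eq_square mult.assoc)
    qed
    have eig: "M *v e = c *\<^sub>R e"
    proof -
      \<comment> \<open>The part of \<open>M *v e\<close> orthogonal to \<open>e\<close>;
        \<open>ortho\<close> makes it orthogonal to \<open>M *v e\<close> as well, hence to
        itself.\<close>
      define w where "w = M *v e - c *\<^sub>R e"
      have "w \<in> S" unfolding w_def using eS less.prems by (simp add: subspace_diff subspace_scale)
      moreover have we: "w \<bullet> e = 0"
        using inner_commute[of e "M *v e"] by (simp add: w_def inner_diff_left ee c_def)
      ultimately have "w \<bullet> (M *v e) = 0" by (rule ortho)
      then have "w \<bullet> w = 0" using we by (simp add: w_def inner_diff_right)
      then show ?thesis by (simp add: w_def)
    qed
    define S' where "S' = {x \<in> S. x \<bullet> e = 0}"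
    have sub: "subspace S'" using less.prems(1)
      by (auto simp: S'_def subspace_def inner_add_left)
    have inv: "M *v x \<in> S'" if "x \<in> S'" for x
      using that less.prems(2) inner_symmetric_matrix[OF sym, of x e] eig by (simp add: S'_def)
    have "e \<notin> S'" by (simp add: S'_def ee)
    then have "S' \<subset> S" using eS unfolding S'_def by blast
    then have "span S' \<subset> span S" using sub less.prems(1) by (simp add: span_eq_iff[THEN iffD2])
    then have "dim S' < dim S" by (rule dim_psubset)
    from less.hyps[OF this sub inv] obtain B where
      B: "pairwise orthogonal B" "\<forall>e\<in>B. norm e = 1 \<and> (\<exists>c. M *v e = c *\<^sub>R e)" "span B = S'" by blast
    have "span (insert e B) = S"
    proof
      show "span (insert e B) \<subseteq> S"
        using B(3) eS less.prems(1) span_superset[of B]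
        by (intro span_minimal) (auto simp: S'_def)
      show "S \<subseteq> span (insert e B)"
      proof
        fix x assume "x \<in> S"
        then have "x - (x \<bullet> e) *\<^sub>R e \<in> span B" unfolding B(3) S'_def
          using eS less.prems(1) by (simp add: subspace_diff subspace_scale inner_diff_left ee)
        then show "x \<in> span (insert e B)" by (auto simp: span_insert)
      qed
    qed
    moreover have "pairwise orthogonal (insert e B)"
      using B(1,3) span_superset[of B]
      by (auto simp: pairwise_insert orthogonal_def S'_def inner_commute)
    ultimately show ?thesis using B(2) ne eig by (intro exI[of _ "insert e B"]) auto
  qed
qed

definition orthonormal_basis :: "'a::euclidean_space set \<Rightarrow> bool" where
  "orthonormal_basis B \<longleftrightarrow> pairwise orthogonal B \<and> (\<forall>e\<in>B. norm e = 1) \<and> span B = UNIV"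

lemma orthonormal_basis_finite: "orthonormal_basis B \<Longrightarrow> finite B"
  by (simp add: orthonormal_basis_def pairwise_orthogonal_imp_finite)

lemma orthonormal_basis_inner:
  assumes "orthonormal_basis B" "e \<in> B" "e' \<in> B"
  shows "e \<bullet> e' = (if e = e' then 1 else 0)"
  using assms by (auto simp: orthonormal_basis_def pairwise_def orthogonal_def norm_eq_1)

lemma orthonormal_basis_sum:
  assumes "orthonormal_basis B"
  shows "(\<Sum>e\<in>B. (e \<bullet> x) *\<^sub>R e) = x"
  using orthonormal_basis_expand[of B x] assms orthonormal_basis_finite[OF assms]
  by (simp add: orthonormal_basis_def inner_commute)

text \<open>The sum of the rank-one matrices \<open>e\<close> times its transpose, weighted by
  \<open>c e\<close>. Over a fixed orthonormal basis, matrix products become products of the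
  weights, so square roots and pseudoinverses can be computed on \<open>c\<close> alone.\<close>

definition spectral_matrix :: "(real^'a) set \<Rightarrow> (real^'a \<Rightarrow> real) \<Rightarrow> real^'a^'a" where
  "spectral_matrix B c = (\<chi> i j. \<Sum>e\<in>B. c e * e $ i * e $ j)"

lemma spectral_matrix_mult_vec:
  "spectral_matrix B c *v x = (\<Sum>e\<in>B. (c e * (e \<bullet> x)) *\<^sub>R e)"
proof (subst vec_eq_iff, intro allI)
  fix i
  have "(\<Sum>j\<in>UNIV. (\<Sum>e\<in>B. c e * e $ i * e $ j) * x $ j) = (\<Sum>e\<in>B. \<Sum>j\<in>UNIV. c e * e $ i * e $ j * x $ j)"
    by (subst sum.swap) (simp add: sum_distrib_right)
  then show "(spectral_matrix B c *v x) $ i = (\<Sum>e\<in>B. (c e * (e \<bullet> x)) *\<^sub>R e) $ i"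
    by (simp add: spectral_matrix_def matrix_vector_mult_def inner_vec_def sum_distrib_left sum_distrib_right mult_ac)
qed

lemma inner_spectral_matrix:
  "x \<bullet> (spectral_matrix B c *v y) = (\<Sum>e\<in>B. c e * (e \<bullet> x) * (e \<bullet> y))"
  by (simp add: spectral_matrix_mult_vec inner_sum_right inner_commute mult_ac)

lemma spectral_matrix_mult:
  assumes "orthonormal_basis B"
  shows "spectral_matrix B c ** spectral_matrix B c' = spectral_matrix B (\<lambda>e. c e * c' e)"
proof -
  have "e \<bullet> (spectral_matrix B c' *v x) = c' e * (e \<bullet> x)" if "e \<in> B" for e x
    using that orthonormal_basis_finite[OF assms]
    by (simp add: inner_spectral_matrix orthonormal_basis_inner[OF assms _ that] if_distrib if_distribR cong: if_cong sum.cong)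
  then show ?thesis
    by (simp add: matrix_eq matrix_vector_mul_assoc[symmetric] spectral_matrix_mult_vec[of B c]
        spectral_matrix_mult_vec[of B "\<lambda>e. c e * c' e"] mult.assoc)
qed

lemma spectral_matrix_eigenvector:
  assumes "orthonormal_basis B" "e \<in> B"
  shows "spectral_matrix B c *v e = c e *\<^sub>R e"
proof -
  have "spectral_matrix B c *v e = (\<Sum>b\<in>B. if b = e then c e *\<^sub>R e else 0)"
    unfolding spectral_matrix_mult_vec
    by (intro sum.cong refl) (simp add: orthonormal_basis_inner[OF assms(1) _ assms(2)])
  then show ?thesis using assms orthonormal_basis_finite[OF assms(1)] by simp
qed

lemma transpose_spectral_matrix: "transpose (spectral_matrix B c) = spectral_matrix B c"
  by (simp add: spectral_matrix_def vec_eq_iff transpose_def mult_ac)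

lemma spectral_matrix_eqI:
  assumes "orthonormal_basis B" "\<And>e. e \<in> B \<Longrightarrow> M *v e = c e *\<^sub>R e"
  shows "M = spectral_matrix B c"
proof (subst matrix_eq, intro allI)
  fix x
  have "M *v x = M *v (\<Sum>e\<in>B. (e \<bullet> x) *\<^sub>R e)" by (simp add: orthonormal_basis_sum[OF assms(1)])
  also have "\<dots> = spectral_matrix B c *v x"
    by (simp add: matrix_vector_mult_sum matrix_vector_mult_scaleR assms(2) spectral_matrix_mult_vec mult.commute)
  finally show "M *v x = spectral_matrix B c *v x" .
qed

theorem symmetric_matrix_spectral:
  fixes M :: "real^'a^'a"
  assumes "transpose M = M"
  obtains B c where "orthonormal_basis B" "M = spectral_matrix B c"
proof -
  obtain B where B: "pairwise orthogonal B" "\<forall>e\<in>B. norm e = 1 \<and> (\<exists>c. M *v e = c *\<^sub>R e)"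
      "span B = UNIV"
    using symmetric_matrix_eigenbasis_subspace[OF assms, of UNIV] by auto
  obtain c where "\<And>e. e \<in> B \<Longrightarrow> M *v e = c e *\<^sub>R e"
    using B(2) by metis
  moreover have "orthonormal_basis B" using B by (simp add: orthonormal_basis_def)
  ultimately show ?thesis using that spectral_matrix_eqI by blast
qed

section \<open>Square roots and pseudoinverses\<close>

lemma sym_psd_spectral_matrix:
  "(\<And>e. e \<in> B \<Longrightarrow> 0 \<le> c e) \<Longrightarrow> sym_psd (spectral_matrix B c)"
  by (auto simp: sym_psd_def transpose_spectral_matrix inner_spectral_matrix mult.assoc intro!: sum_nonneg)

lemma sym_psd_spectral:
  fixes M :: "real^'a^'a"
  assumes "sym_psd M"
  obtains B c where "orthonormal_basis B" "M = spectral_matrix B c" "\<And>e. e \<in> B \<Longrightarrow> 0 \<le> c e"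
proof -
  obtain B c where B: "orthonormal_basis B" "M = spectral_matrix B c"
    using assms symmetric_matrix_spectral unfolding sym_psd_def by blast
  have "0 \<le> c e" if "e \<in> B" for e
  proof -
    have "0 \<le> e \<bullet> (M *v e)" using assms by (simp add: sym_psd_def)
    then show ?thesis
      by (simp add: B(2) spectral_matrix_eigenvector[OF B(1) that] orthonormal_basis_inner[OF B(1) that that])
  qed
  then show ?thesis using that B by blast
qed

text \<open>This gives the uniqueness of the square root. The vector
  \<open>R *v e - sqrt c *\<^sub>R e\<close> is mapped by \<open>R\<close> to
  \<open>- sqrt c\<close> times itself, which positive semidefiniteness forbids unless it is zero or
  \<open>c = 0\<close>; in the latter case the squared norm of \<open>R *v e\<close> is
  \<open>e \<bullet> (R *v (R *v e)) = 0\<close>.\<close>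

lemma sym_psd_square_root_eigenvector:
  assumes "sym_psd R" "(R ** R) *v e = c *\<^sub>R e" "0 \<le> c"
  shows "R *v e = sqrt c *\<^sub>R e"
proof -
  define u where "u = R *v e - sqrt c *\<^sub>R e"
  have RR: "R *v (R *v e) = c *\<^sub>R e" using assms(2) by (simp add: matrix_vector_mul_assoc)
  have Ru: "R *v u = - (sqrt c *\<^sub>R u)"
    using assms(3) by (simp add: u_def matrix_vector_mult_diff_distrib matrix_vector_mult_scaleR RR algebra_simps)
  have "0 \<le> u \<bullet> (R *v u)" using assms(1) by (simp add: sym_psd_def)
  then have "sqrt c * (u \<bullet> u) \<le> 0" by (simp add: Ru)
  then have "u = 0 \<or> c = 0" using assms(3)
    by (metis inner_eq_zero_iff inner_ge_zero mult_eq_0_iff mult_nonneg_nonneg order_antisym real_sqrt_eq_zero_cancel_iff real_sqrt_ge_zero)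
  then show ?thesis
  proof
    assume "u = 0" then show ?thesis by (simp add: u_def)
  next
    assume "c = 0"
    have "(R *v e) \<bullet> (R *v e) = e \<bullet> (R *v (R *v e))"
      using inner_symmetric_matrix[of R e "R *v e"] assms(1) by (simp add: sym_psd_def)
    then show ?thesis using RR \<open>c = 0\<close> by simp
  qed
qed

text \<open>Every positive semidefinite root has to act on the eigenbasis by the roots of the
  eigenvalues, which supplies the uniqueness that the description operator in
  \<open>psd_sqrt\<close> requires.\<close>

lemma psd_sqrt_spectral_matrix:
  assumes "orthonormal_basis B" "\<And>e. e \<in> B \<Longrightarrow> 0 \<le> c e"
  shows "psd_sqrt (spectral_matrix B c) = spectral_matrix B (\<lambda>e. sqrt (c e))"
  unfolding psd_sqrt_def
proof (rule the_equality)
  have "spectral_matrix B (\<lambda>e. sqrt (c e) * sqrt (c e)) = spectral_matrix B c"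
    using assms by (intro spectral_matrix_eqI) (auto simp: spectral_matrix_eigenvector)
  then show "sym_psd (spectral_matrix B (\<lambda>e. sqrt (c e))) \<and>
      spectral_matrix B (\<lambda>e. sqrt (c e)) ** spectral_matrix B (\<lambda>e. sqrt (c e)) = spectral_matrix B c"
    using assms by (simp add: sym_psd_spectral_matrix spectral_matrix_mult)
next
  fix R assume R: "sym_psd R \<and> R ** R = spectral_matrix B c"
  show "R = spectral_matrix B (\<lambda>e. sqrt (c e))"
  proof (rule spectral_matrix_eqI[OF assms(1)])
    fix e assume "e \<in> B"
    then show "R *v e = sqrt (c e) *\<^sub>R e"
      using R assms spectral_matrix_eigenvector[OF assms(1) \<open>e \<in> B\<close>, of c]
      by (intro sym_psd_square_root_eigenvector) auto
  qed
qed

lemma pinv_unique: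
  fixes M :: "real^'a^'b"
  assumes "M ** Q ** M = M" "Q ** M ** Q = Q" "transpose (M ** Q) = M ** Q" "transpose (Q ** M) = Q ** M"
  shows "pinv M = Q"
  unfolding pinv_def
proof (rule the_equality)
  fix R assume R: "M ** R ** M = M \<and> R ** M ** R = R
     \<and> transpose (M ** R) = M ** R \<and> transpose (R ** M) = R ** M"
  \<comment> \<open>Both factors are symmetric, so their product is the transpose of the product in
    reverse order, where \<open>M ** Q ** M\<close> collapses.\<close>
  have "(M ** R) ** (M ** Q) = transpose (M ** Q ** M ** R)"
    using assms R by (metis matrix_transpose_mul matrix_mul_assoc)
  also have "\<dots> = M ** R" using assms R by simp
  finally have 1: "(M ** R) ** (M ** Q) = M ** R" .
  have "(R ** M) ** (Q ** M) = transpose (Q ** (M ** R ** M))"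
    using assms R by (metis matrix_transpose_mul matrix_mul_assoc)
  also have "\<dots> = Q ** M" using assms R by simp
  finally have 2: "(R ** M) ** (Q ** M) = Q ** M" .
  have "Q = Q ** M ** Q" using assms by simp
  also have "\<dots> = Q ** (M ** R ** M) ** Q" using R by simp
  also have "\<dots> = Q ** ((M ** R) ** (M ** Q))" by (simp add: matrix_mul_assoc)
  also have "\<dots> = Q ** M ** R" unfolding 1 by (simp add: matrix_mul_assoc)
  also have "\<dots> = (R ** M) ** (Q ** M) ** R" by (simp only: 2)
  also have "\<dots> = R ** (M ** Q ** M) ** R" by (simp add: matrix_mul_assoc)
  also have "\<dots> = R" using assms R by simp
  finally show "R = Q" by simp
qed (use assms in auto)

text \<open>Since \<^term>\<open>inverse (0::real) = 0\<close>, inverting the eigenvalues gives the pseudoinverse.\<close>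

lemma pinv_spectral_matrix:
  assumes "orthonormal_basis B"
  shows "pinv (spectral_matrix B c) = spectral_matrix B (\<lambda>e. inverse (c e))"
proof (rule pinv_unique)
  have "(\<lambda>e. c e * inverse (c e) * c e) = c" by (rule ext) (simp add: field_simps)
  then show "spectral_matrix B c ** spectral_matrix B (\<lambda>e. inverse (c e)) ** spectral_matrix B c = spectral_matrix B c"
    by (simp add: spectral_matrix_mult[OF assms])
  have "(\<lambda>e. inverse (c e) * c e * inverse (c e)) = (\<lambda>e. inverse (c e))" by (rule ext) (simp add: field_simps)
  then show "spectral_matrix B (\<lambda>e. inverse (c e)) ** spectral_matrix B c ** spectral_matrix B (\<lambda>e. inverse (c e))
    = spectral_matrix B (\<lambda>e. inverse (c e))"
    by (simp add: spectral_matrix_mult[OF assms])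
qed (simp_all add: spectral_matrix_mult[OF assms] transpose_spectral_matrix)

lemma psd_sqrt_square:
  assumes "sym_psd M"
  shows "sym_psd (psd_sqrt M)" "psd_sqrt M ** psd_sqrt M = M"
proof -
  obtain B c where B: "orthonormal_basis B" "M = spectral_matrix B c" "\<And>e. e \<in> B \<Longrightarrow> 0 \<le> c e"
    using sym_psd_spectral[OF assms] by blast
  have R: "psd_sqrt M = spectral_matrix B (\<lambda>e. sqrt (c e))"
    using psd_sqrt_spectral_matrix[OF B(1,3)] B(2) by simp
  show "sym_psd (psd_sqrt M)" using B(3) by (simp add: R sym_psd_spectral_matrix)
  have "M = spectral_matrix B (\<lambda>e. sqrt (c e) * sqrt (c e))"
    using B by (intro spectral_matrix_eqI) (auto simp: spectral_matrix_eigenvector)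
  then show "psd_sqrt M ** psd_sqrt M = M" unfolding R by (simp add: spectral_matrix_mult[OF B(1)])
qed

text \<open>All matrices involved are diagonal in one eigenbasis, which reduces each identity to one
  between real numbers; zero eigenvalues are covered by \<open>inverse 0 = 0\<close>.\<close>

lemma pinv_psd_sqrt:
  assumes "sym_psd M"
  shows "transpose (pinv (psd_sqrt M)) = pinv (psd_sqrt M)"
    and "pinv (psd_sqrt M) ** psd_sqrt M = psd_sqrt M ** pinv (psd_sqrt M)"
    and "psd_sqrt M ** pinv (psd_sqrt M) ** psd_sqrt M = psd_sqrt M"
    and "pinv M = pinv (psd_sqrt M) ** pinv (psd_sqrt M)"
proof -
  obtain B c where B: "orthonormal_basis B" "M = spectral_matrix B c" "\<And>e. e \<in> B \<Longrightarrow> 0 \<le> c e"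
    using sym_psd_spectral[OF assms] by blast
  define d where "d = (\<lambda>e. sqrt (c e))"
  have R: "psd_sqrt M = spectral_matrix B d"
    using psd_sqrt_spectral_matrix[OF B(1,3)] B(2) by (simp add: d_def)
  have Q: "pinv (psd_sqrt M) = spectral_matrix B (\<lambda>e. inverse (d e))"
    by (simp add: R pinv_spectral_matrix[OF B(1)])
  show "transpose (pinv (psd_sqrt M)) = pinv (psd_sqrt M)" by (simp add: Q transpose_spectral_matrix)
  show "pinv (psd_sqrt M) ** psd_sqrt M = psd_sqrt M ** pinv (psd_sqrt M)"
    unfolding Q unfolding R by (simp add: spectral_matrix_mult[OF B(1)] mult.commute)
  have "(\<lambda>e. d e * inverse (d e) * d e) = d" by (rule ext) (simp add: field_simps)
  then show "psd_sqrt M ** pinv (psd_sqrt M) ** psd_sqrt M = psd_sqrt M"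
    unfolding Q unfolding R by (simp add: spectral_matrix_mult[OF B(1)])
  have "spectral_matrix B (\<lambda>e. inverse (c e)) = spectral_matrix B (\<lambda>e. inverse (d e) * inverse (d e))"
    using B by (intro spectral_matrix_eqI) (auto simp: spectral_matrix_eigenvector d_def simp flip: inverse_mult_distrib)
  then show "pinv M = pinv (psd_sqrt M) ** pinv (psd_sqrt M)"
    unfolding Q by (simp add: B(2) pinv_spectral_matrix[OF B(1)] spectral_matrix_mult[OF B(1)])
qed

text \<open>Expand \<open>u\<close> in an eigenbasis and bound each weight. Since
  \<open>lambda_max\<close> is a \<open>Max\<close>, it bounds the eigenvalues only once their set
  is known to be finite.\<close>

lemma rayleigh_le_lambda_max:
  fixes M :: "real^'a^'a"
  assumes "transpose M = M"
  shows "u \<bullet> (M *v u) \<le> lambda_max M * (u \<bullet> u)"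
proof -
  obtain B c where B: "orthonormal_basis B" "M = spectral_matrix B c"
    using symmetric_matrix_spectral[OF assms] by blast
  have eig: "eigenvalue M (c e)" if "e \<in> B" for e
    unfolding eigenvalue_def using B that orthonormal_basis_inner[OF B(1) that that]
    by (intro exI[of _ e]) (auto simp: spectral_matrix_eigenvector)
  have "l \<in> c ` B" if ev: "eigenvalue M l" for l
  proof -
    obtain w where w: "w \<noteq> 0" "M *v w = l *\<^sub>R w" using ev by (auto simp: eigenvalue_def)
    \<comment> \<open>An eigenvector \<open>w\<close> has a nonzero coordinate along some
      \<open>e\<close>; comparing that coordinate in \<open>M *v w\<close> forces
      \<open>l = c e\<close>.\<close>
    obtain e where e: "e \<in> B" "e \<bullet> w \<noteq> 0"
      using orthonormal_basis_sum[OF B(1), of w] w(1) by (metis (no_types, lifting) scaleR_zero_left sum.neutral)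
    have "e \<bullet> (M *v w) = c e * (e \<bullet> w)"
      using inner_symmetric_matrix[OF assms, of e w] e B by (simp add: spectral_matrix_eigenvector)
    then show ?thesis using e w(2) by auto
  qed
  then have "finite {l. eigenvalue M l}"
    using orthonormal_basis_finite[OF B(1)] by (auto intro: finite_subset[of _ "c ` B"])
  then have "c e \<le> lambda_max M" if "e \<in> B" for e
    using eig[OF that] by (auto simp: lambda_max_def)
  then have "u \<bullet> (M *v u) \<le> (\<Sum>e\<in>B. lambda_max M * (e \<bullet> u)\<^sup>2)"
    by (auto simp: B(2) inner_spectral_matrix power2_eq_square mult.assoc intro!: sum_mono mult_right_mono)
  also have "\<dots> = lambda_max M * (u \<bullet> (\<Sum>e\<in>B. (e \<bullet> u) *\<^sub>R e))"
    by (simp add: sum_distrib_left inner_sum_right power2_eq_square inner_commute)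
  finally show ?thesis by (simp add: orthonormal_basis_sum[OF B(1)])
qed

section \<open>Seminorms of positive semidefinite matrices\<close>

lemma wnorm_sq: "sym_psd M \<Longrightarrow> (wnorm M u)\<^sup>2 = u \<bullet> (M *v u)"
  by (simp add: wnorm_def sym_psd_def)

lemma wnorm_eq_norm_psd_sqrt:
  assumes "sym_psd M"
  shows "wnorm M u = norm (psd_sqrt M *v u)"
  using inner_symmetric_matrix[of "psd_sqrt M" u "psd_sqrt M *v u"] psd_sqrt_square[OF assms]
  by (simp add: wnorm_def norm_eq_sqrt_inner matrix_vector_mul_assoc sym_psd_def)

lemma wnorm_cauchy_schwarz:
  assumes "sym_psd M"
  shows "u \<bullet> (M *v v) \<le> wnorm M u * wnorm M v"
proof -
  have "u \<bullet> (M *v v) = (psd_sqrt M *v u) \<bullet> (psd_sqrt M *v v)"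
    using inner_symmetric_matrix[of "psd_sqrt M" u "psd_sqrt M *v v"] psd_sqrt_square[OF assms]
    by (simp add: matrix_vector_mul_assoc sym_psd_def)
  then show ?thesis using norm_cauchy_schwarz by (simp add: wnorm_eq_norm_psd_sqrt[OF assms])
qed

lemma wnorm_triangle_sub:
  assumes "sym_psd M"
  shows "wnorm M (u - v) \<le> wnorm M u + wnorm M v"
  by (simp add: wnorm_eq_norm_psd_sqrt[OF assms] matrix_vector_mult_diff_distrib norm_triangle_ineq4)

section \<open>Block structure\<close>

lemma sum_UNIV_sum_type:
  fixes F :: "'a::finite + 'b::finite \<Rightarrow> 'c::comm_monoid_add"
  shows "(\<Sum>c\<in>UNIV. F c) = (\<Sum>a\<in>UNIV. F (Inl a)) + (\<Sum>b\<in>UNIV. F (Inr b))"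
  by (simp add: UNIV_Plus_UNIV[symmetric] sum.Plus del: UNIV_Plus_UNIV)

lemma sum_UNIV_prod_type:
  fixes F :: "'a::finite \<times> 'b::finite \<Rightarrow> 'c::comm_monoid_add"
  shows "(\<Sum>r\<in>UNIV. F r) = (\<Sum>b\<in>UNIV. \<Sum>a\<in>UNIV. F (a, b))"
  by (subst sum.swap) (simp add: UNIV_Times_UNIV[symmetric] sum.cartesian_product del: UNIV_Times_UNIV)

lemma stack_nth [simp]: "stack u v $ Inl a = u $ a" "stack u v $ Inr b = v $ b"
  by (simp_all add: stack_def)

lemma stack_diff: "stack u v - stack u' v' = stack (u - u') (v - v')"
  by (auto simp: vec_eq_iff stack_def split: sum.split)

lemma inner_stack: "stack u v \<bullet> stack u' v' = u \<bullet> u' + v \<bullet> v'"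
  by (simp add: inner_vec_def sum_UNIV_sum_type)

lemma block_diag_mult_stack: "block_diag M Q *v stack u v = stack (M *v u) (Q *v v)"
  by (auto simp: vec_eq_iff stack_def matrix_vector_mult_def block_diag_def sum_UNIV_sum_type split: sum.split)

text \<open>Collects one fixed component over all agents. A matrix \<open>kron P (mat 1)\<close>
  acts on every slice separately, as \<open>P\<close>.\<close>

definition slice :: "'c \<Rightarrow> real^('n::finite \<times> 'c::finite) \<Rightarrow> real^'n" where
  "slice c y = (\<chi> i. y $ (i, c))"

lemma slice_nth [simp]: "slice c y $ i = y $ (i, c)"
  by (simp add: slice_def)

lemma inner_slice: "u \<bullet> w = (\<Sum>c\<in>UNIV. slice c u \<bullet> slice c w)"
  by (simp add: inner_vec_def sum_UNIV_prod_type)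

lemma slice_kron: "slice c (kron P (mat 1) *v y) = P *v slice c y"
proof (subst vec_eq_iff, intro allI)
  fix i
  have "(kron P (mat 1) *v y) $ (i, c) = (\<Sum>b\<in>UNIV. \<Sum>j\<in>UNIV. P $ i $ j * (if c = b then 1 else 0) * y $ (j, b))"
    by (simp add: matrix_vector_mult_def kron_def mat_def sum_UNIV_prod_type)
  also have "\<dots> = (\<Sum>b\<in>UNIV. if c = b then (P *v slice c y) $ i else 0)"
    by (intro sum.cong refl) (simp add: matrix_vector_mult_def)
  finally show "slice c (kron P (mat 1) *v y) $ i = (P *v slice c y) $ i" by simp
qed

lemma kron_eq_0_iff: "kron P (mat 1) *v y = 0 \<longleftrightarrow> (\<forall>c. P *v slice c y = 0)"
  unfolding slice_kron[symmetric] by (auto simp: vec_eq_iff)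

lemma slice_replicate_vec: "slice c (replicate_vec y) = y $ c *\<^sub>R 1"
  by (simp add: vec_eq_iff replicate_vec_def)

lemma transpose_kron: "transpose (kron P Q) = kron (transpose P) (transpose Q)"
  by (simp add: vec_eq_iff transpose_def kron_def)

lemma sym_psd_kron: "sym_psd P \<Longrightarrow> sym_psd (kron P (mat 1))"
  by (auto simp: sym_psd_def transpose_kron inner_slice slice_kron intro!: sum_nonneg)

lemma kron_add_scaleR: "kron P R + c *\<^sub>R kron Q R = kron (P + c *\<^sub>R Q) R"
  by (simp add: vec_eq_iff kron_def algebra_simps)

lemma kron_diff: "kron P R - kron Q R = kron (P - Q) R"
  by (simp add: vec_eq_iff kron_def algebra_simps)

lemma kron_diagonal_mult_vec:
  assumes "diagonal P"
  shows "(kron P (mat 1) *v y) $ (i, c) = P $ i $ i * y $ (i, c)"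
proof -
  have "(kron P (mat 1) *v y) $ (i, c) = (P *v slice c y) $ i"
    by (simp flip: slice_kron)
  also have "\<dots> = (\<Sum>j\<in>UNIV. if j = i then P $ i $ i * y $ (i, c) else 0)"
    unfolding matrix_vector_mult_def vec_lambda_beta using assms
    by (intro sum.cong) (auto simp: diagonal_def)
  finally show ?thesis by simp
qed

lemma kron_diagonal_inverse_mult_vec:
  assumes "diagonal P" "\<And>i. P $ i $ i \<noteq> 0"
  shows "(matrix_inv (kron P (mat 1)) *v y) $ (i, c) = y $ (i, c) / P $ i $ i"
proof -
  define Q where "Q = (\<chi> i j. if i = j then 1 / P $ i $ i else 0)"
  have Q: "diagonal Q" "\<And>i. Q $ i $ i = 1 / P $ i $ i"
    by (auto simp: diagonal_def Q_def)
  let ?D = "kron P (mat 1 :: real^'b^'b)" and ?E = "kron Q (mat 1 :: real^'b^'b)"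
  have "?D *v (?E *v u) = u" "?E *v (?D *v u) = u" for u
    using assms Q by (auto simp: vec_eq_iff kron_diagonal_mult_vec)
  then have "?D ** ?E = mat 1" "?E ** ?D = mat 1"
    by (simp_all add: matrix_eq matrix_vector_mul_assoc[symmetric])
  then have E: "?D ** ?E = mat 1 \<and> ?E ** ?D = mat 1" by simp
  \<comment> \<open>\<open>matrix_inv\<close> is a choice among two-sided inverses; the existence of
    \<open>?E\<close> makes the choice meaningful, and uniqueness of inverses identifies it with
    \<open>?E\<close>.\<close>
  have "matrix_inv ?D ** ?D = mat 1"
    unfolding matrix_inv_def using someI[of "\<lambda>R. ?D ** R = mat 1 \<and> R ** ?D = mat 1", OF E] by simp
  then have "matrix_inv ?D = ?E"
    using E by (metis matrix_mul_assoc matrix_mul_lid matrix_mul_rid)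
  then show ?thesis using Q by (simp add: kron_diagonal_mult_vec)
qed

lemma inner_replicate_vec: "replicate_vec y \<bullet> w = (\<Sum>c\<in>UNIV. y $ c * (\<Sum>i\<in>UNIV. w $ (i, c)))"
  by (simp add: inner_slice slice_replicate_vec) (simp add: inner_vec_def)

text \<open>Each slice of a replicated vector is a multiple of the all-ones vector, whose squared
  norm is the number of agents; the Rayleigh bound applies slice by slice.\<close>

lemma replicate_vec_quadratic_form:
  fixes P :: "real^'n^'n" and y :: "real^'c"
  assumes "transpose P = P"
  shows "replicate_vec y \<bullet> (kron P (mat 1) *v replicate_vec y) \<le> real CARD('n) * lambda_max P * (norm y)\<^sup>2"
proof -
  have one: "(1 :: real^'n) \<bullet> 1 = real CARD('n)" by (simp add: inner_vec_def)
  have "replicate_vec y \<bullet> (kron P (mat 1) *v replicate_vec y)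
      = (\<Sum>c\<in>UNIV. (y $ c)\<^sup>2 * ((1 :: real^'n) \<bullet> (P *v 1)))"
    by (simp add: inner_slice slice_kron slice_replicate_vec matrix_vector_mult_scaleR power2_eq_square mult.assoc)
  also have "\<dots> \<le> (\<Sum>c\<in>UNIV. (y $ c)\<^sup>2 * (lambda_max P * real CARD('n)))"
    using rayleigh_le_lambda_max[OF assms, of 1] one by (intro sum_mono mult_left_mono) auto
  also have "\<dots> = real CARD('n) * lambda_max P * (norm y)\<^sup>2"
    unfolding power2_norm_eq_inner by (simp add: sum_distrib_right[symmetric] inner_vec_def power2_eq_square)
  finally show ?thesis .
qed

lemma kron_replicate_vec_eq_0:
  assumes "null_space P = span {1}"
  shows "kron P (mat 1) *v replicate_vec y = 0"
proof -
  have "(1 :: real^'a) \<in> null_space P" using assms by (simp add: span_base)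
  then show ?thesis
    by (simp add: kron_eq_0_iff slice_replicate_vec matrix_vector_mult_scaleR null_space_def)
qed

section \<open>The cone and its projection\<close>

text \<open>The order induced by the dual cone of \<open>cone_K\<close>: the difference
  \<open>w - u\<close> is nonnegative in the inequality components and zero in the equality
  components.\<close>

definition cone_le :: "real^('n::finite \<times> ('m::finite + 'p::finite)) \<Rightarrow> real^('n \<times> ('m + 'p)) \<Rightarrow> bool" where
  "cone_le u w \<longleftrightarrow> (\<forall>i a. u $ (i, Inl a) \<le> w $ (i, Inl a)) \<and> (\<forall>i b. u $ (i, Inr b) = w $ (i, Inr b))"

lemma cone_le_inner:
  assumes "cone_le u w" "y \<in> cone_K"
  shows "y \<bullet> u \<le> y \<bullet> w"
  using assms
  by (auto simp: inner_vec_def sum_UNIV_prod_type sum_UNIV_sum_type cone_le_def cone_K_def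
      intro!: sum_mono mult_left_mono add_mono)

lemma proj_K_nth:
  fixes u :: "real^('n::finite \<times> ('m::finite + 'p::finite))"
  shows "proj_K u $ (i, Inl a) = max 0 (u $ (i, Inl a))" (is ?t1)
    and "proj_K u $ (i, Inr b) = u $ (i, Inr b)" (is ?t2)
proof -
  \<comment> \<open>\<open>cone_K\<close> is a product of half-lines and lines, so the projection
    clips each coordinate on its own.\<close>
  define w where "w = (\<chi> r. case snd r of Inl _ \<Rightarrow> max 0 (u $ r) | Inr _ \<Rightarrow> u $ r)"
  have "w = closest_point cone_K u"
  proof (rule closest_point_unique)
    show "convex (cone_K :: (real^('n \<times> ('m + 'p))) set)"
      by (auto simp: convex_def cone_K_def)
    show "closed (cone_K :: (real^('n \<times> ('m + 'p))) set)"
      unfolding cone_K_def by (intro closed_Collect_all closed_Collect_le continuous_intros)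
    show "w \<in> cone_K" by (simp add: w_def cone_K_def)
    show "\<forall>y\<in>cone_K. dist u w \<le> dist u y"
    proof
      fix y :: "real^('n \<times> ('m + 'p))" assume y: "y \<in> cone_K"
      have "\<bar>u $ (i, c) - w $ (i, c)\<bar> \<le> \<bar>u $ (i, c) - y $ (i, c)\<bar>" for i c
      proof (cases c)
        case (Inl a)
        have "0 \<le> y $ (i, Inl a)" using y by (simp add: cone_K_def)
        then show ?thesis by (simp add: Inl w_def)
      qed (simp add: w_def)
      then have "\<bar>u $ r - w $ r\<bar> \<le> \<bar>u $ r - y $ r\<bar>" for r
        by (cases r) blast
      then show "dist u w \<le> dist u y"
        by (simp add: dist_norm norm_vec_def L2_set_mono)
    qed
  qed
  then have "proj_K u = w" by (simp add: proj_K_def)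
  then show ?t1 ?t2 by (simp_all add: w_def)
qed

text \<open>The square of the positive part is nondecreasing, and its derivative is Lipschitz with
  constant 2, hence the quadratic upper model. Monotonicity permits \<open>u'\<close> to lie merely
  below \<open>u + e\<close> in the inequality components.\<close>

lemma proj_K_mono_square:
  assumes "cone_le u' (u + e)"
  shows "(proj_K u' $ r)\<^sup>2 \<le> (proj_K u $ r)\<^sup>2 + 2 * proj_K u $ r * e $ r + (e $ r)\<^sup>2"
proof (cases r)
  case (Pair i c)
  show ?thesis
  proof (cases c)
    case (Inl a)
    define p q d where "p = u' $ r" and "q = u $ r" and "d = e $ r"
    have "p \<le> q + d" using assms by (simp add: cone_le_def Pair Inl p_def q_def d_def)
    then have le: "max 0 p \<le> max 0 (q + d)" by simp
    have "(max 0 p)\<^sup>2 \<le> (max 0 (q + d))\<^sup>2" using le by (intro power_mono) auto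
    also have "\<dots> \<le> (max 0 q)\<^sup>2 + 2 * max 0 q * d + d\<^sup>2"
    proof (cases "0 \<le> q")
      case True
      have "(max 0 (q + d))\<^sup>2 \<le> (q + d)\<^sup>2" by (auto simp: max_def)
      then show ?thesis using True by (simp add: power2_sum algebra_simps max_def)
    next
      case False
      then have "max 0 (q + d) \<le> \<bar>d\<bar>" by auto
      then have "(max 0 (q + d))\<^sup>2 \<le> \<bar>d\<bar>\<^sup>2" by (intro power_mono) auto
      then show ?thesis using False by simp
    qed
    finally show ?thesis by (simp add: Pair Inl p_def q_def d_def proj_K_nth)
  next
    case (Inr b)
    then show ?thesis using assms
      by (simp add: cone_le_def Pair proj_K_nth power2_sum algebra_simps)
  qed
qed

section \<open>Convexity of the constraint-coupled problem\<close>

lemma convex_prod_set: "(\<And>i. convex (X i)) \<Longrightarrow> convex (prod_set X)"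
  by (auto simp: convex_def prod_set_def)

lemma convex_on_agent_sum:
  assumes "\<And>i. convex (X i)" "\<And>i. convex_on (X i) (f i)"
  shows "convex_on (prod_set X) (agent_sum f)"
  unfolding convex_on_def
proof (intro conjI ballI allI impI)
  show "convex (prod_set X)" by (rule convex_prod_set[OF assms(1)])
  fix x u and s t :: real
  assume "x \<in> prod_set X" "u \<in> prod_set X" "0 \<le> s" "0 \<le> t" "s + t = 1"
  then have "f i ((s *\<^sub>R x + t *\<^sub>R u) $ i) \<le> s * f i (x $ i) + t * f i (u $ i)" for i
    using assms(2)[of i] by (simp add: convex_on_def prod_set_def)
  then show "agent_sum f (s *\<^sub>R x + t *\<^sub>R u) \<le> s * agent_sum f x + t * agent_sum f u"
    unfolding agent_sum_def by (simp add: sum_distrib_left sum.distrib[symmetric] sum_mono)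
qed

lemma g_tilde_nth [simp]:
  "g_tilde g h x $ (i, Inl a) = g i (x $ i) $ a"
  "g_tilde g h x $ (i, Inr b) = h i (x $ i) $ b"
  by (simp_all add: g_tilde_def)

text \<open>Convexity of the stacked constraint map in the dual cone order; pairing it with an
  element of \<open>cone_K\<close> then yields a convex function.\<close>

lemma cone_le_g_tilde_convex_comb:
  assumes "\<And>i a. convex_on (X i) (\<lambda>u. g i u $ a)" "\<And>i. affine_on (X i) (h i)"
    and "x \<in> prod_set X" "u \<in> prod_set X" "0 \<le> s" "0 \<le> t" "s + t = 1"
  shows "cone_le (g_tilde g h (s *\<^sub>R x + t *\<^sub>R u)) (s *\<^sub>R g_tilde g h x + t *\<^sub>R g_tilde g h u)"
  using assms by (simp add: cone_le_def affine_on_def convex_on_def prod_set_def)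

lemma convex_on_inner_g_tilde:
  assumes "\<And>i. convex (X i)" "\<And>i a. convex_on (X i) (\<lambda>u. g i u $ a)" "\<And>i. affine_on (X i) (h i)"
    and "y \<in> cone_K"
  shows "convex_on (prod_set X) (\<lambda>x. y \<bullet> g_tilde g h x)"
  unfolding convex_on_def
proof (intro conjI ballI allI impI)
  show "convex (prod_set X)" by (rule convex_prod_set[OF assms(1)])
  fix x u and s t :: real
  assume "x \<in> prod_set X" "u \<in> prod_set X" "0 \<le> s" "0 \<le> t" "s + t = 1"
  from cone_le_inner[OF cone_le_g_tilde_convex_comb[of X g h, OF assms(2,3) this] assms(4)]
  show "y \<bullet> g_tilde g h (s *\<^sub>R x + t *\<^sub>R u) \<le> s * (y \<bullet> g_tilde g h x) + t * (y \<bullet> g_tilde g h u)"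
    by (simp add: inner_add_right)
qed

lemma inner_replicate_g_tilde:
  "replicate_vec (stack \<mu> la) \<bullet> g_tilde g h x = \<mu> \<bullet> agent_sum g x + la \<bullet> agent_sum h x"
  unfolding inner_replicate_vec sum_UNIV_sum_type by (simp add: agent_sum_def inner_vec_def)

lemma replicate_stack_in_cone_K: "replicate_vec (stack \<mu> la) \<in> cone_K \<longleftrightarrow> (\<forall>a. 0 \<le> \<mu> $ a)"
  by (simp add: cone_K_def replicate_vec_def)

text \<open>With zero duality gap the optimal cost equals the dual value, an infimum of the
  Lagrangian, and so lies below the Lagrangian at every point of \<open>prod_set X\<close>.\<close>

lemma primal_dual_optimal_saddle:
  assumes "primal_dual_optimal X f g h xs \<mu> la"
  shows "\<forall>a. 0 \<le> \<mu> $ a"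
    and "x \<in> prod_set X \<Longrightarrow> agent_sum f xs \<le> agent_sum f x + replicate_vec (stack \<mu> la) \<bullet> g_tilde g h x"
proof -
  show "\<forall>a. 0 \<le> \<mu> $ a"
    using assms by (auto simp: primal_dual_optimal_def is_arg_max_def)
  assume "x \<in> prod_set X"
  then have "dual_fun X f g h \<mu> la \<le> ereal (lagrangian f g h \<mu> la x)"
    unfolding dual_fun_def by (rule INF_lower)
  then show "agent_sum f xs \<le> agent_sum f x + replicate_vec (stack \<mu> la) \<bullet> g_tilde g h x"
    using assms by (simp add: primal_dual_optimal_def lagrangian_def inner_replicate_g_tilde add.assoc)
qed

text \<open>The defect of \<^term>\<open>w\<close> from being in the range of \<^term>\<open>Hs\<close> consists of copies of
  the average constraint value, which is nonpositive by feasibility.\<close>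

lemma cone_le_range_projection:
  fixes Hs :: "real^('n::finite \<times> ('m::finite + 'p::finite))^('n \<times> ('m + 'p))"
  assumes "transpose Hs = Hs" "Hs ** Hs = kron P (mat 1)" "null_space P = span {1}"
    and "Hs *v r = 0" "\<And>u. Hs *v replicate_vec u = 0"
    and w: "w = Hs *v q + r"
    and "\<And>a. (\<Sum>i\<in>UNIV. w $ (i, Inl a)) \<le> 0" "\<And>b. (\<Sum>i\<in>UNIV. w $ (i, Inr b)) = 0"
  shows "cone_le w (Hs *v q)"
proof -
  have "(Hs ** Hs) *v r = 0"
    using assms(4) by (simp flip: matrix_vector_mul_assoc)
  then have "slice c r \<in> null_space P" for c
    unfolding assms(2) by (simp add: kron_eq_0_iff null_space_def)
  then have "\<exists>\<alpha>. slice c r = \<alpha> *\<^sub>R 1" for c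
    unfolding assms(3) span_singleton by blast
  then obtain \<alpha> where \<alpha>: "\<And>c. slice c r = \<alpha> c *\<^sub>R 1" by metis
  have r: "r $ (i, c) = \<alpha> c" for i c
    using arg_cong[OF \<alpha>[of c], of "\<lambda>v. v $ i"] by simp
  have sum_r: "(\<Sum>i\<in>UNIV. w $ (i, c)) = real CARD('n) * \<alpha> c" for c
  proof -
    \<comment> \<open>Replicated vectors are orthogonal to the range of the symmetric matrix
      \<open>Hs\<close>. Testing with a replicated unit vector shows that summing component
      \<open>c\<close> over the agents leaves only the contribution of \<open>r\<close>.\<close>
    have "replicate_vec (axis c 1) \<bullet> (Hs *v q) = 0"
      by (simp add: inner_symmetric_matrix[OF assms(1)] assms(5))
    then have "(\<Sum>i\<in>UNIV. (Hs *v q) $ (i, c)) = 0"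
      by (simp add: inner_replicate_vec axis_def if_distrib if_distribR cong: if_cong)
    then show ?thesis by (simp add: w sum.distrib r)
  qed
  have "\<alpha> (Inl a) \<le> 0" "\<alpha> (Inr b) = 0" for a b
    using sum_r[of "Inl a"] sum_r[of "Inr b"] assms(7)[of a] assms(8)[of b]
    by (simp_all add: mult_le_0_iff)
  then show ?thesis by (simp add: cone_le_def w r)
qed

section \<open>One step of the algorithm\<close>

text \<open>Scaling by positive diagonal entries commutes with clipping at zero. The conclusions are
  the optimality conditions of the dual step: membership in the cone, dual feasibility of the
  residual, and complementarity.\<close>

lemma duca_step_cone:
  assumes "diagonal P" "\<And>i. P $ i $ i > 0"
    and y: "y = proj_K (matrix_inv (kron P (mat 1)) *v w)"
  shows "y \<in> cone_K" "kron P (mat 1) *v y = proj_K w"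
    "cone_le w (kron P (mat 1) *v y)" "y \<bullet> w = y \<bullet> (kron P (mat 1) *v y)"
proof -
  have inv: "(matrix_inv (kron P (mat 1)) *v w) $ (i, c) = w $ (i, c) / P $ i $ i" for i c
    using assms(2) by (intro kron_diagonal_inverse_mult_vec[OF assms(1)]) (simp add: less_imp_neq[symmetric])
  have yl: "y $ (i, Inl a) = max 0 (w $ (i, Inl a)) / P $ i $ i" for i a
    using assms(2)[of i] by (simp add: y proj_K_nth inv max_def divide_le_0_iff zero_le_divide_iff)
  have yr: "y $ (i, Inr b) = w $ (i, Inr b) / P $ i $ i" for i b
    by (simp add: y proj_K_nth inv)
  have ne: "P $ i $ i \<noteq> 0" for i using assms(2)[of i] by simp
  show "y \<in> cone_K"
    using assms(2) by (auto simp: cone_K_def yl less_imp_le)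
  have nth: "(kron P (mat 1) *v y) $ (i, Inl a) = proj_K w $ (i, Inl a)"
    "(kron P (mat 1) *v y) $ (i, Inr b) = proj_K w $ (i, Inr b)" for i a b
    using ne by (simp_all add: kron_diagonal_mult_vec[OF assms(1)] yl yr proj_K_nth)
  show Dy: "kron P (mat 1) *v y = proj_K w"
  proof (subst vec_eq_iff, intro allI)
    fix r show "(kron P (mat 1) *v y) $ r = proj_K w $ r"
      by (cases r; cases "snd r") (simp_all add: nth)
  qed
  show "cone_le w (kron P (mat 1) *v y)"
    by (simp add: Dy cone_le_def proj_K_nth)
  show "y \<bullet> w = y \<bullet> (kron P (mat 1) *v y)"
    unfolding Dy by (auto simp: inner_vec_def sum_UNIV_prod_type sum_UNIV_sum_type yl proj_K_nth max_def
        intro!: sum.cong arg_cong2[where f = "(+)"])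
qed

text \<open>Replaces a one-sided limit \<open>t \<rightarrow> 0\<close> when a first-order condition
  is extracted from inequalities along a segment.\<close>

lemma le_0_if_le_all_multiples:
  fixes b c :: real
  assumes "\<And>t. 0 < t \<Longrightarrow> t \<le> 1 \<Longrightarrow> b \<le> t * c"
  shows "b \<le> 0"
proof (rule field_le_epsilon)
  fix e :: real assume "0 < e"
  define t where "t = min 1 (e / (\<bar>c\<bar> + 1))"
  have t: "0 < t" "t \<le> 1" using \<open>0 < e\<close> by (auto simp: t_def)
  have "t * c \<le> t * (\<bar>c\<bar> + 1)" using t by (intro mult_left_mono) auto
  also have "\<dots> \<le> e / (\<bar>c\<bar> + 1) * (\<bar>c\<bar> + 1)" by (intro mult_right_mono) (auto simp: t_def)
  also have "\<dots> = e" by simp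
  finally show "b \<le> 0 + e" using assms[OF t] by simp
qed

text \<open>The penalty has derivative \<^term>\<open>y\<close> with respect to the constraint values, and it is monotone
  in the inequality components, so moving along a segment towards \<^term>\<open>u\<close> gives the first-order
  condition without differentiability of \<^term>\<open>f\<close>.\<close>

lemma duca_primal_step_optimality:
  fixes g :: "'n::finite \<Rightarrow> real^'d \<Rightarrow> real^'m::finite" and h :: "'n \<Rightarrow> real^'d \<Rightarrow> real^'p::finite"
  assumes X: "\<And>i. convex (X i)" "\<And>i. convex_on (X i) (f i)"
    and gh: "\<And>i a. convex_on (X i) (\<lambda>u. g i u $ a)" "\<And>i. affine_on (X i) (h i)"
    and P: "diagonal P" "\<And>i. P $ i $ i > 0"
    and min: "is_arg_min (\<lambda>x'. agent_sum f x' + (1/2) *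
       (wnorm (matrix_inv (kron P (mat 1))) (proj_K (q + g_tilde g h x')))\<^sup>2) (\<lambda>x'. x' \<in> prod_set X) x"
    and y: "y = proj_K (matrix_inv (kron P (mat 1)) *v (q + g_tilde g h x))"
    and u: "u \<in> prod_set X"
  shows "agent_sum f x + y \<bullet> g_tilde g h x \<le> agent_sum f u + y \<bullet> g_tilde g h u"
proof -
  define E where "E = matrix_inv (kron P (mat 1 :: real^('m + 'p)^('m + 'p)))"
  have E: "(E *v w) $ r = w $ r / P $ fst r $ fst r" for w r
    unfolding E_def using P(2) kron_diagonal_inverse_mult_vec[OF P(1), of w "fst r" "snd r"]
    by (simp add: less_imp_neq[symmetric])
  have pos: "0 < P $ fst r $ fst r" for r :: "'n \<times> ('m + 'p)" by (rule P(2))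
  have wn: "(wnorm E w)\<^sup>2 = (\<Sum>r\<in>UNIV. (w $ r)\<^sup>2 / P $ fst r $ fst r)" for w
  proof -
    have "w \<bullet> (E *v w) = (\<Sum>r\<in>UNIV. (w $ r)\<^sup>2 / P $ fst r $ fst r)"
      by (simp add: inner_vec_def E power2_eq_square)
    then show ?thesis
      by (simp add: wnorm_def sum_nonneg pos less_imp_le)
  qed
  define Q where "Q = (\<lambda>x. q + g_tilde g h x)"
  have x: "x \<in> prod_set X" using min by (simp add: is_arg_min_def)
  have y_eq: "y $ r = proj_K (Q x) $ r / P $ fst r $ fst r" for r
    using duca_step_cone(2)[OF P y] kron_diagonal_mult_vec[OF P(1), of y "fst r" "snd r"] pos[of r]
    by (simp add: Q_def)
  define e where "e = g_tilde g h u - g_tilde g h x"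
  have "agent_sum f x - agent_sum f u - y \<bullet> e \<le> 0"
  proof (rule le_0_if_le_all_multiples)
    fix t :: real assume t: "0 < t" "t \<le> 1"
    define x' where "x' = (1 - t) *\<^sub>R x + t *\<^sub>R u"
    have x': "x' \<in> prod_set X"
      unfolding x'_def using convex_prod_set[of X, OF X(1)] x u t by (intro convexD) auto
    have fx': "agent_sum f x' \<le> (1 - t) * agent_sum f x + t * agent_sum f u"
      unfolding x'_def using convex_on_agent_sum[of X f, OF X] x u t by (auto simp: convex_on_def)
    have "cone_le (g_tilde g h x') ((1 - t) *\<^sub>R g_tilde g h x + t *\<^sub>R g_tilde g h u)"
      unfolding x'_def using t x u by (intro cone_le_g_tilde_convex_comb[OF gh]) auto
    then have "cone_le (Q x') (Q x + t *\<^sub>R e)"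
      by (simp add: cone_le_def Q_def e_def algebra_simps)
    note sq = proj_K_mono_square[OF this]
    have "(wnorm E (proj_K (Q x')))\<^sup>2
        \<le> (\<Sum>r\<in>UNIV. ((proj_K (Q x) $ r)\<^sup>2 + 2 * proj_K (Q x) $ r * (t *\<^sub>R e) $ r + ((t *\<^sub>R e) $ r)\<^sup>2) / P $ fst r $ fst r)"
      unfolding wn by (intro sum_mono divide_right_mono sq less_imp_le[OF pos])
    also have "\<dots> = (wnorm E (proj_K (Q x)))\<^sup>2 + 2 * t * (y \<bullet> e) + t\<^sup>2 * (wnorm E e)\<^sup>2"
      unfolding wn by (simp add: inner_vec_def y_eq sum_distrib_left sum.distrib[symmetric] add_divide_distrib
          power_mult_distrib mult_ac)
    finally have "(wnorm E (proj_K (Q x')))\<^sup>2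
        \<le> (wnorm E (proj_K (Q x)))\<^sup>2 + 2 * t * (y \<bullet> e) + t\<^sup>2 * (wnorm E e)\<^sup>2" .
    moreover have "agent_sum f x + (1/2) * (wnorm E (proj_K (Q x)))\<^sup>2
        \<le> agent_sum f x' + (1/2) * (wnorm E (proj_K (Q x')))\<^sup>2"
      using min x' by (auto simp: is_arg_min_linorder E_def Q_def)
    \<comment> \<open>Every term carries a factor \<open>t\<close>; once it is cancelled, only the
      quadratic remainder still depends on \<open>t\<close>, and it vanishes as \<open>t\<close>
      tends to 0.\<close>
    ultimately have "t * (agent_sum f x - agent_sum f u - y \<bullet> e) \<le> t * (t * ((wnorm E e)\<^sup>2 / 2))"
      using fx' by (simp add: algebra_simps power2_eq_square)
    then show "agent_sum f x - agent_sum f u - y \<bullet> e \<le> t * ((wnorm E e)\<^sup>2 / 2)"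
      using t by simp
  qed
  then show ?thesis by (simp add: e_def inner_diff_right)
qed

text \<open>The squared seminorm of the stacked vector for the block diagonal matrix with blocks
  \<open>A\<close> and the identity divided by \<open>\<rho>\<close>.\<close>

definition lyapunov :: "real^'a^'a \<Rightarrow> real \<Rightarrow> real^'a \<Rightarrow> real^'a \<Rightarrow> real" where
  "lyapunov A \<rho> u w = u \<bullet> (A *v u) + (w \<bullet> w) / \<rho>"

text \<open>The change of the \<open>A\<close> part is
  \<open>2 * (p' \<bullet> (A *v (p' - p)))\<close> minus a nonnegative square. Expanding the
  \<open>z\<close> part leaves the excess \<open>\<rho> * (d \<bullet> d)\<close>, which the term
  with \<open>H\<close> absorbs because \<open>H\<close> dominates \<open>Hs ** Hs\<close>.\<close>

lemma lyapunov_step: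
  fixes A H Hs :: "real^'a^'a"
  assumes A: "sym_psd A" and Hs: "transpose Hs = Hs" and H: "sym_psd (H - Hs ** Hs)"
    and "\<rho> > 0" and Y: "H *v Y = 0" "Hs *v Y = 0" and z': "z' = z + \<rho> *\<^sub>R (Hs *v y')"
  shows "lyapunov A \<rho> (y' - Y) (z' - Z) - lyapunov A \<rho> (y - Y) (z - Z)
     \<le> 2 * ((y' - Y) \<bullet> ((A + \<rho> *\<^sub>R H) *v y' - A *v y + Hs *v z - Hs *v Z))"
proof -
  define d where "d = Hs *v y'"
  define p p' where "p = y - Y" and "p' = y' - Y"
  have d: "d = Hs *v p'" using Y by (simp add: d_def p'_def matrix_vector_mult_diff_distrib)
  have "(H - Hs ** Hs) *v p' = H *v p' - Hs *v d"
    by (simp add: matrix_vector_mult_diff_rdistrib matrix_vector_mul_assoc d)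
  then have "d \<bullet> d \<le> p' \<bullet> (H *v p')"
    using H inner_symmetric_matrix[OF Hs, of p' d] by (auto simp: sym_psd_def inner_diff_right d dest!: spec[of _ p'])
  then have Hd: "\<rho> * (d \<bullet> d) \<le> \<rho> * (p' \<bullet> (H *v p'))" using \<open>\<rho> > 0\<close> by simp
  have "(z' - Z) \<bullet> (z' - Z) = (z - Z) \<bullet> (z - Z) + 2 * \<rho> * (d \<bullet> (z - Z)) + \<rho>\<^sup>2 * (d \<bullet> d)"
    by (simp add: z' d_def[symmetric] inner_add_left inner_add_right inner_diff_left inner_diff_right
        inner_commute algebra_simps power2_eq_square)
  then have "((z' - Z) \<bullet> (z' - Z)) / \<rho> = ((z - Z) \<bullet> (z - Z)) / \<rho> + 2 * (d \<bullet> (z - Z)) + \<rho> * (d \<bullet> d)"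
    using \<open>\<rho> > 0\<close> by (simp add: field_simps power2_eq_square)
  moreover have "0 \<le> (p' - p) \<bullet> (A *v (p' - p))" using A by (simp add: sym_psd_def)
  then have "p' \<bullet> (A *v p') - p \<bullet> (A *v p) \<le> 2 * (p' \<bullet> (A *v (p' - p)))"
    using inner_symmetric_matrix[of A p p'] A
    by (simp add: sym_psd_def inner_diff_left inner_diff_right matrix_vector_mult_diff_distrib inner_commute)
  moreover have "(A + \<rho> *\<^sub>R H) *v y' - A *v y + Hs *v z - Hs *v Z
      = A *v (p' - p) + \<rho> *\<^sub>R (H *v p') + Hs *v (z - Z)"
    using Y by (simp add: p_def p'_def matrix_vector_mult_diff_distrib matrix_vector_mult_add_rdistrib scaleR_matrix_vector_assoc)
  moreover have "p' \<bullet> (Hs *v (z - Z)) = d \<bullet> (z - Z)"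
    using inner_symmetric_matrix[OF Hs] by (simp add: d)
  moreover have "0 \<le> d \<bullet> d" by simp
  then have "0 \<le> \<rho> * (d \<bullet> d)" using \<open>\<rho> > 0\<close> by simp
  ultimately show ?thesis using Hd
    unfolding lyapunov_def p_def[symmetric] p'_def[symmetric]
    by (simp add: inner_add_right)
qed

section \<open>Convergence rate\<close>

theorem theorem3:
  fixes C :: "'n::finite \<Rightarrow> 'd::finite set"
    and X :: "'n \<Rightarrow> (real^'d) set"
    and f :: "'n \<Rightarrow> real^'d \<Rightarrow> real"
    and g :: "'n \<Rightarrow> real^'d \<Rightarrow> real^'m::finite"
    and h :: "'n \<Rightarrow> real^'d \<Rightarrow> real^'p::finite"
    and P_A P_H P_Ht :: "real^'n^'n"
    and \<rho> :: real
    and A H Ht Hs D :: "real^('n \<times> ('m + 'p))^('n \<times> ('m + 'p))"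
    and G :: "real^(('n \<times> ('m + 'p)) + ('n \<times> ('m + 'p)))^(('n \<times> ('m + 'p)) + ('n \<times> ('m + 'p)))"
    and x :: "nat \<Rightarrow> real^'d^'n"
    and y z v :: "nat \<Rightarrow> real^('n \<times> ('m + 'p))"
    and s :: "nat \<Rightarrow> real^(('n \<times> ('m + 'p)) + ('n \<times> ('m + 'p)))"
    and xbar :: "nat \<Rightarrow> real^'d^'n"
    and xstar :: "real^'d^'n"
    and mustar :: "real^'m" and lastar :: "real^'p"
    and ystar :: "real^('m + 'p)"
    and Ystar zstar vstar :: "real^('n \<times> ('m + 'p))"
    and sstar :: "real^(('n \<times> ('m + 'p)) + ('n \<times> ('m + 'p)))"
    and R1 R2 :: real
    and k :: nat
  assumes X_dim: "\<And>i. X i \<subseteq> coord_subspace (C i)"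
    and X_convex: "\<And>i. convex (X i)"
    and f_convex: "\<And>i. convex_on (X i) (f i)"
    and g_convex: "\<And>i a. convex_on (X i) (\<lambda>u. g i u $ a)"
    and h_affine: "\<And>i. affine_on (X i) (h i)"
    and opt_exists: "\<exists>x'. cc_optimal X f g h x'"
    and slater: "slater X g h"
    and P_psd: "sym_psd P_A" "sym_psd P_H" "sym_psd P_Ht"
    and P_D_pd: "sym_pd (P_A + \<rho> *\<^sub>R P_H)"
    and P_H_ge: "sym_psd (P_H - P_Ht)"
    and P_H_null: "null_space P_H = span {1}"
    and P_Ht_null: "null_space P_Ht = span {1}"
    and X_compact: "\<And>i. compact (X i)"
    and P_D_diag: "diagonal (P_A + \<rho> *\<^sub>R P_H)"
    and rho_pos: "\<rho> > 0"
    and A_eq: "A = kron P_A (mat 1)"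
    and H_eq: "H = kron P_H (mat 1)"
    and Ht_eq: "Ht = kron P_Ht (mat 1)"
    and Hs_eq: "Hs = psd_sqrt Ht"
    and D_eq: "D = A + \<rho> *\<^sub>R H"
    and run: "duca X f g h A Hs D \<rho> x y z"
    and pd_optimal: "primal_dual_optimal X f g h xstar mustar lastar"
    and ystar_eq: "ystar = stack mustar lastar"
    and Ystar_eq: "Ystar = replicate_vec ystar"
    and zstar_eq: "zstar = pinv Hs *v g_tilde g h xstar"
    and v_eq: "\<And>l. v l = Hs *v z l"
    and vstar_eq: "vstar = Hs *v zstar"
    and s_eq: "\<And>l. s l = stack (y l) (z l)"
    and sstar_eq: "sstar = stack Ystar zstar"
    and G_eq: "G = block_diag A ((1 / \<rho>) *\<^sub>R mat 1)"
    and xbar_eq: "\<And>l. xbar l = (1 / real l) *\<^sub>R (\<Sum>j=1..l. x j)"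
    and R1_eq: "R1 = norm ystar * sqrt (real CARD('n) * lambda_max P_A)
                  * (wnorm A (y 0 - Ystar) + wnorm G (s 0 - sstar))"
    and R2_eq: "R2 = 1 / (2 * \<rho>) * (wnorm (pinv Ht) (v 0 - vstar))\<^sup>2 + 1 / 2 * (wnorm A (y 0))\<^sup>2"
    and k_ge: "k \<ge> 1"
  shows "- (R1 / real k) \<le> agent_sum f (xbar k) - agent_sum f xstar
       \<and> agent_sum f (xbar k) - agent_sum f xstar \<le> R2 / real k"
proof -

  \<comment> \<open>Matrices of the algorithm and their null spaces\<close>
  define P where "P = P_A + \<rho> *\<^sub>R P_H"
  define V where "V Y Z l = lyapunov A \<rho> (y l - Y) (z l - Z)" for Y Z l
  define fs where "fs = agent_sum f xstar"
  define gs where "gs = g_tilde g h xstar"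
  have A: "sym_psd A" unfolding A_eq by (rule sym_psd_kron[OF P_psd(1)])
  have Ht: "sym_psd Ht" unfolding Ht_eq by (rule sym_psd_kron[OF P_psd(3)])
  have Hs: "transpose Hs = Hs" "Hs ** Hs = Ht"
    using psd_sqrt_square[OF Ht] by (simp_all add: Hs_eq sym_psd_def)
  have H_ge: "sym_psd (H - Hs ** Hs)"
    unfolding Hs(2) H_eq Ht_eq kron_diff by (rule sym_psd_kron[OF P_H_ge])
  have D: "D = kron P (mat 1)"
    by (simp add: D_eq A_eq H_eq P_def kron_add_scaleR)
  have P: "diagonal P" using P_D_diag by (simp add: P_def)
  have P_pos: "P $ i $ i > 0" for i
  proof -
    have "(axis i 1 :: real^'n) \<noteq> 0" by (simp add: axis_eq_0_iff)
    then have "0 < axis i 1 \<bullet> (P *v axis i 1)"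
      using P_D_pd by (simp add: P_def sym_pd_def)
    then show ?thesis by (simp add: inner_axis' matrix_vector_mult_basis column_def)
  qed
  have H_rep: "H *v replicate_vec u = 0" for u
    unfolding H_eq by (rule kron_replicate_vec_eq_0[OF P_H_null])
  have Hs_rep: "Hs *v replicate_vec u = 0" for u
  proof -
    \<comment> \<open>A symmetric matrix and its square have the same null space.\<close>
    have "Hs *v (Hs *v replicate_vec u) = 0"
      using kron_replicate_vec_eq_0[OF P_Ht_null] by (simp add: matrix_vector_mul_assoc Hs(2) Ht_eq)
    then have "(Hs *v replicate_vec u) \<bullet> (Hs *v replicate_vec u) = 0"
      by (simp flip: inner_symmetric_matrix[OF Hs(1)])
    then show ?thesis by simp
  qed

  have x_min: "is_arg_min (\<lambda>x'. agent_sum f x' + (1/2) *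
      (wnorm (matrix_inv D) (proj_K (A *v y l - v l + g_tilde g h x')))\<^sup>2)
      (\<lambda>x'. x' \<in> prod_set X) (x (Suc l))"
    and y_Suc: "y (Suc l) = proj_K (matrix_inv D *v (A *v y l - v l + g_tilde g h (x (Suc l))))"
    and z_Suc: "z (Suc l) = z l + \<rho> *\<^sub>R (Hs *v y (Suc l))" for l
    using run by (simp_all add: duca_def v_eq)
  have x_in: "x (Suc l) \<in> prod_set X" for l
    using x_min[of l] by (simp add: is_arg_min_def)

  \<comment> \<open>Feasibility and the saddle point property of the optimal pair\<close>
  have xs: "cc_feasible X g h xstar"
    using pd_optimal by (simp add: primal_dual_optimal_def cc_optimal_def is_arg_min_def)
  then have xs_in: "xstar \<in> prod_set X" by (simp add: cc_feasible_def)
  have Ystar_K: "Ystar \<in> cone_K"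
    using primal_dual_optimal_saddle(1)[OF pd_optimal]
    by (simp add: Ystar_eq ystar_eq replicate_stack_in_cone_K)
  have saddle: "fs \<le> agent_sum f u + Ystar \<bullet> g_tilde g h u" if "u \<in> prod_set X" for u
    using primal_dual_optimal_saddle(2)[OF pd_optimal that] by (simp add: Ystar_eq ystar_eq fs_def)

  \<comment> \<open>\<open>vstar\<close> is the orthogonal projection of \<open>gs\<close> onto the
    range of \<open>Hs\<close>; what is left over lies in the null space of
    \<open>Hs\<close>.\<close>
  have gs_le: "cone_le gs vstar"
    unfolding vstar_eq
  proof (rule cone_le_range_projection[OF Hs(1) _ P_Ht_null _ Hs_rep])
    show "Hs ** Hs = kron P_Ht (mat 1)" by (simp add: Hs(2) Ht_eq)
    have "Hs *v vstar = (Hs ** pinv Hs ** Hs) *v gs"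
      using pinv_psd_sqrt(2)[OF Ht]
      by (simp add: vstar_eq zstar_eq gs_def Hs_eq matrix_vector_mul_assoc matrix_mul_assoc[symmetric])
    then show "Hs *v (gs - Hs *v zstar) = 0"
      using pinv_psd_sqrt(3)[OF Ht] by (simp add: Hs_eq vstar_eq matrix_vector_mult_diff_distrib)
    show "gs = Hs *v zstar + (gs - Hs *v zstar)" by simp
    have "(\<Sum>i\<in>UNIV. gs $ (i, Inl a)) = agent_sum g xstar $ a" for a
      by (simp add: gs_def agent_sum_def)
    then show "(\<Sum>i\<in>UNIV. gs $ (i, Inl a)) \<le> 0" for a
      using xs by (simp add: cc_feasible_def)
    have "(\<Sum>i\<in>UNIV. gs $ (i, Inr b)) = agent_sum h xstar $ b" for b
      by (simp add: gs_def agent_sum_def)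
    then show "(\<Sum>i\<in>UNIV. gs $ (i, Inr b)) = 0" for b
      using xs by (simp add: cc_feasible_def)
  qed

  \<comment> \<open>Descent of the Lyapunov function\<close>
  have decrease: "V Y Z (Suc l) - V Y Z l
      \<le> 2 * (fs - agent_sum f (x (Suc l)) - Y \<bullet> g_tilde g h (x (Suc l)))"
    if Y: "Y \<in> cone_K" "H *v Y = 0" "Hs *v Y = 0" and Z: "Hs *v Z = vstar" for Y Z l
  proof -
    let ?y = "y (Suc l)" and ?g = "g_tilde g h (x (Suc l))"
    define w where "w = A *v y l - v l + ?g"
    note step = duca_step_cone[OF P P_pos, of ?y w, folded D, OF y_Suc[of l, folded w_def]]
    \<comment> \<open>Complementarity removes the part with \<open>?y\<close>, and dual feasibility
      gives the part with \<open>Y\<close> its sign.\<close>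
    have "?y \<bullet> (D *v ?y - w) = 0" using step(4) by (simp add: inner_diff_right)
    moreover have "0 \<le> Y \<bullet> (D *v ?y - w)"
      using cone_le_inner[OF step(3) Y(1)] by (simp add: inner_diff_right)
    ultimately have "(?y - Y) \<bullet> (D *v ?y - w) \<le> 0" by (simp add: inner_diff_left)
    then have 1: "(?y - Y) \<bullet> (D *v ?y - A *v y l + v l - vstar) \<le> (?y - Y) \<bullet> ?g - (?y - Y) \<bullet> vstar"
      by (simp add: w_def inner_diff_right inner_add_right)
    have "Y \<bullet> vstar = 0"
      using inner_symmetric_matrix[OF Hs(1), of Y zstar] Y(3) by (simp add: vstar_eq)
    then have 2: "?y \<bullet> gs \<le> (?y - Y) \<bullet> vstar"
      using cone_le_inner[OF gs_le step(1)] by (simp add: inner_diff_left)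
    \<comment> \<open>The linearized optimality of the primal step, tested at
      \<open>xstar\<close>.\<close>
    have 3: "agent_sum f (x (Suc l)) + ?y \<bullet> ?g \<le> fs + ?y \<bullet> gs"
      unfolding fs_def gs_def
      by (rule duca_primal_step_optimality[OF X_convex f_convex g_convex h_affine P P_pos
            x_min[unfolded D] y_Suc[unfolded D] xs_in])
    have "V Y Z (Suc l) - V Y Z l \<le> 2 * ((?y - Y) \<bullet> (D *v ?y - A *v y l + v l - vstar))"
      unfolding V_def D_eq v_eq Z[symmetric]
      by (rule lyapunov_step[OF A Hs(1) H_ge rho_pos Y(2,3) z_Suc])
    with 1 2 3 show ?thesis by (simp add: inner_diff_left)
  qed

  have V_nonneg: "0 \<le> V Y Z l" for Y Z l
    using A rho_pos by (simp add: V_def lyapunov_def sym_psd_def)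

  \<comment> \<open>Averaged iterates and the upper bound\<close>
  have mean: "F (xbar k) \<le> (1 / real k) * (\<Sum>l<k. F (x (Suc l)))"
    if "convex_on (prod_set X) F" for F
  proof -
    \<comment> \<open>The average runs over \<open>x 1\<close> to \<open>x k\<close>; reindexed as
      \<open>x (Suc l)\<close> with \<open>l < k\<close>, it matches the telescoping sums.\<close>
    have xb: "xbar k = (\<Sum>l<k. (1 / real k) *\<^sub>R x (Suc l))"
      by (simp add: xbar_eq scaleR_sum_right sum.atLeast1_atMost_eq)
    have "{..<k} \<noteq> {}" using k_ge by (auto simp: set_eq_iff intro!: exI[of _ 0])
    then show ?thesis unfolding xb sum_distrib_left
      using that k_ge x_in by (intro convex_on_sum) auto
  qed
  have xbar_in: "xbar k \<in> prod_set X"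
  proof -
    have "(\<Sum>l<k. (1 / real k) *\<^sub>R x (Suc l)) \<in> prod_set X"
      by (rule convex_sum) (use k_ge x_in convex_prod_set[of X, OF X_convex] in auto)
    then show ?thesis
      by (simp add: xbar_eq scaleR_sum_right sum.atLeast1_atMost_eq)
  qed

  \<comment> \<open>Shifting \<^term>\<open>zstar\<close> along the null space of \<^term>\<open>Hs\<close> turns the distance from \<^term>\<open>z 0\<close>
    into the pseudoinverse norm of \<^term>\<open>v 0 - vstar\<close>.\<close>
  define Z0 where "Z0 = z 0 - pinv Hs *v (Hs *v (z 0 - zstar))"
  have Z0: "Hs *v Z0 = vstar"
  proof -
    have "Hs *v (pinv Hs *v (Hs *v (z 0 - zstar))) = Hs *v (z 0 - zstar)"
      using pinv_psd_sqrt(3)[OF Ht] by (simp add: Hs_eq matrix_vector_mul_assoc matrix_mul_assoc)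
    then show ?thesis by (simp add: Z0_def vstar_eq matrix_vector_mult_diff_distrib)
  qed
  have "(wnorm (pinv Ht) (v 0 - vstar))\<^sup>2 = (z 0 - Z0) \<bullet> (z 0 - Z0)"
  proof -
    have e: "v 0 - vstar = Hs *v (z 0 - zstar)"
      by (simp add: v_eq vstar_eq matrix_vector_mult_diff_distrib)
    have "(v 0 - vstar) \<bullet> (pinv Ht *v (v 0 - vstar)) = (z 0 - Z0) \<bullet> (z 0 - Z0)"
      using inner_symmetric_matrix[OF pinv_psd_sqrt(1)[OF Ht], of "v 0 - vstar" "pinv Hs *v (v 0 - vstar)"]
      by (simp add: Z0_def e pinv_psd_sqrt(4)[OF Ht] Hs_eq matrix_vector_mul_assoc[symmetric])
    then show ?thesis by (simp add: wnorm_def)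
  qed
  then have R2: "R2 = V 0 Z0 0 / 2"
    using wnorm_sq[OF A] by (simp add: R2_eq V_def lyapunov_def)
  \<comment> \<open>\<open>Y = 0\<close> removes the constraint term from the descent inequality,
    and \<open>Z0\<close> makes the initial Lyapunov value equal to \<open>2 * R2\<close>.\<close>
  have "2 * (\<Sum>l<k. agent_sum f (x (Suc l)) - fs) \<le> (\<Sum>l<k. V 0 Z0 l - V 0 Z0 (Suc l))"
    unfolding sum_distrib_left
  proof (rule sum_mono)
    fix l
    have "0 \<in> cone_K" by (simp add: cone_K_def)
    from decrease[OF this _ _ Z0, of l]
    show "2 * (agent_sum f (x (Suc l)) - fs) \<le> V 0 Z0 l - V 0 Z0 (Suc l)" by simp
  qed
  also have "\<dots> = V 0 Z0 0 - V 0 Z0 k" by (rule sum_lessThan_telescope')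
  finally have "(\<Sum>l<k. agent_sum f (x (Suc l))) - real k * fs \<le> R2"
    using V_nonneg[of 0 Z0 k] by (simp add: R2 sum_subtractf)
  then have upper: "agent_sum f (xbar k) - fs \<le> R2 / real k"
    using mean[OF convex_on_agent_sum[of X f, OF X_convex f_convex]] k_ge by (simp add: field_simps)

  \<comment> \<open>Lower bound\<close>
  have Ystar_null: "H *v Ystar = 0" "Hs *v Ystar = 0"
    by (simp_all add: Ystar_eq H_rep Hs_rep)
  have "V Ystar zstar (Suc l) \<le> V Ystar zstar l" for l
    using decrease[OF Ystar_K Ystar_null vstar_eq[symmetric], of l] saddle[OF x_in[of l]] by simp
  then have fejer: "V Ystar zstar k \<le> V Ystar zstar 0"
    by (rule lift_Suc_antimono_le) simp
  have G_norm: "wnorm G (s l - sstar) = sqrt (V Ystar zstar l)" for l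
    by (simp add: wnorm_def G_eq s_eq sstar_eq stack_diff block_diag_mult_stack inner_stack V_def
        lyapunov_def scaleR_matrix_vector_assoc[symmetric])
  have "wnorm A (y k - Ystar) \<le> sqrt (V Ystar zstar k)"
    using rho_pos by (simp add: wnorm_def V_def lyapunov_def)
  also have "\<dots> \<le> wnorm G (s 0 - sstar)" using fejer by (simp add: G_norm)
  finally have y_bound: "wnorm A (y k - Ystar) \<le> wnorm G (s 0 - sstar)" .
  have "Ystar \<bullet> (A *v Ystar) \<le> real CARD('n) * lambda_max P_A * (norm ystar)\<^sup>2"
    unfolding Ystar_eq A_eq using P_psd(1) by (intro replicate_vec_quadratic_form) (simp add: sym_psd_def)
  then have "wnorm A Ystar \<le> sqrt (real CARD('n) * lambda_max P_A * (norm ystar)\<^sup>2)"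
    by (simp add: wnorm_def)
  then have Ystar_bound: "wnorm A Ystar \<le> norm ystar * sqrt (real CARD('n) * lambda_max P_A)"
    by (simp add: real_sqrt_mult mult_ac)
  have step_le: "Ystar \<bullet> g_tilde g h (x (Suc l)) \<le> Ystar \<bullet> (A *v y (Suc l)) - Ystar \<bullet> (A *v y l)" for l
  proof -
    \<comment> \<open>Dual feasibility is paired with \<open>Ystar\<close>, which annihilates the
      ranges of \<open>H\<close> and \<open>Hs\<close>; only the differences of the terms with
      \<open>A\<close> survive.\<close>
    note step = duca_step_cone(3)[OF P P_pos y_Suc[of l, unfolded D], folded D]
    have "Ystar \<bullet> (H *v u) = 0" "Ystar \<bullet> (Hs *v u) = 0" for u
      using inner_symmetric_matrix[of H Ystar u] inner_symmetric_matrix[OF Hs(1), of Ystar u] Ystar_null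
        P_psd(2) by (simp_all add: H_eq transpose_kron sym_psd_def)
    then show ?thesis
      using cone_le_inner[OF step Ystar_K]
      by (simp add: D_eq v_eq inner_diff_right inner_add_right matrix_vector_mult_add_rdistrib
          scaleR_matrix_vector_assoc[symmetric])
  qed
  have "(\<Sum>l<k. Ystar \<bullet> g_tilde g h (x (Suc l)))
      \<le> (\<Sum>l<k. Ystar \<bullet> (A *v y (Suc l)) - Ystar \<bullet> (A *v y l))"
    by (intro sum_mono step_le)
  also have "\<dots> = Ystar \<bullet> (A *v (y k - y 0))"
    by (simp add: sum_lessThan_telescope[of "\<lambda>l. Ystar \<bullet> (A *v y l)"] matrix_vector_mult_diff_distrib inner_diff_right)
  also have "\<dots> \<le> wnorm A Ystar * wnorm A (y k - y 0)" by (rule wnorm_cauchy_schwarz[OF A])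
  also have "\<dots> \<le> (norm ystar * sqrt (real CARD('n) * lambda_max P_A))
      * (wnorm A (y 0 - Ystar) + wnorm G (s 0 - sstar))"
  proof (rule mult_mono[OF Ystar_bound])
    have "wnorm A (y k - y 0) \<le> wnorm A (y k - Ystar) + wnorm A (y 0 - Ystar)"
      using wnorm_triangle_sub[OF A, of "y k - Ystar" "y 0 - Ystar"] by simp
    then show "wnorm A (y k - y 0) \<le> wnorm A (y 0 - Ystar) + wnorm G (s 0 - sstar)"
      using y_bound by simp
    \<comment> \<open>The first factor is nonnegative because it dominates a seminorm, so the sign
      of \<open>lambda_max P_A\<close> need not be examined.\<close>
    show "0 \<le> norm ystar * sqrt (real CARD('n) * lambda_max P_A)" "0 \<le> wnorm A (y k - y 0)"
      using Ystar_bound A by (auto simp: wnorm_eq_norm_psd_sqrt intro: order_trans[OF norm_ge_zero])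
  qed
  finally have "(\<Sum>l<k. Ystar \<bullet> g_tilde g h (x (Suc l))) \<le> R1" by (simp add: R1_eq)
  then have "Ystar \<bullet> g_tilde g h (xbar k) \<le> R1 / real k"
    using mean[OF convex_on_inner_g_tilde[of X g h, OF X_convex g_convex h_affine Ystar_K]] k_ge
    by (simp add: field_simps)
  \<comment> \<open>The saddle inequality at the average point turns the bound on the constraint
    term into the lower bound on the cost.\<close>
  then show ?thesis using upper saddle[OF xbar_in] by (simp add: fs_def)
qed

end
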